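(* Let $G$ be a $p$-divisible group over $O_{K,\{1\}}=O_K/pO_K$ with an action of $O_F$, let $(\mathcal{F}_i^{[\bullet]})_{1\le i\le f}$ be adequate filtrations on the spaces $(\mathcal{E}_i)_{1\le i\le f}$, and let $w_i^{[j]}$ be the associated valuations and $w=\sum_{i=1}^f\sum_{j=1}^rw_i^{[j]}$. Assume that $w<1/2$. Then the elements $(w_i^{[j]})_{1\le i\le f,1\le j\le r}$ do not depend on the choice of adequate filtrations (any other choice of adequate filtrations gives the same values), and are thus invariants of the $p$-divisible group $G$.
   Context: Setting. $F/\mathbb{Q}_p$ is a finite unramified extension of degree $f$, with ring of integers $O_F$ and residue field $k=\mathbb{F}_{p^f}$. The embeddings of $F$ are identified with $\mathbb{Z}/f\mathbb{Z}$ via powers of the Frobenius $\sigma$; indices $i$ are read modulo $f$. $K$ is an extension of $\mathbb{Q}_p$ with a (real-valued) valuation $v$ normalized by $v(p)=1$, with ring of integers $O_K$; $O_K/p$ is assumed to be a $k$-algebra. $S=\operatorname{Spec}O_K/p$ and $G$ is a $p$-divisible group over $S$ of height $fh$ with an action of $O_F$. $\mathcal{E}=\bigoplus_{i=1}^f\mathcal{E}_i$ is the contravariant Dieudonné crystal of $G$ evaluated at $S$, with $O_F$ acting on $\mathcal{E}_i$ (free of rank $h$) through $\sigma^i$. Frobenius and Verschiebung give $F_i:\mathcal{E}_{i-1}^{(p)}\to\mathcal{E}_i$ and $V_i:\mathcal{E}_i\to\mathcal{E}_{i-1}^{(p)}$. $\mathcal{F}_i=\omega_{G,i}\subset\mathcal{E}_i$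 is the Hodge filtration, of rank $d_i$, and $\widetilde{\mathcal{F}}_i=\ker V_i=\operatorname{Im}F_i$; also $\mathcal{F}_{i-1}^{(p)}=\operatorname{Im}V_i=\ker F_i$. Let $\delta_1<\dots<\delta_r$ be the distinct elements of $\{d_i\}\cap[1,h-1]$, $\delta_0=0$, $\delta_{r+1}=h$, and define $s(i)\in\{0,\dots,r+1\}$ by $d_i=\delta_{s(i)}$. Adequate filtrations. These consist, for each $i$, of a filtration $$0\subset\mathcal{F}_i^{[s(i)-1]}\subset\dots\subset\mathcal{F}_i^{[1]}\subset\mathcal{F}_i\subset\mathcal{F}_i^{[r]}\subset\dots\subset\mathcal{F}_i^{[s(i)+1]}\subset\mathcal{E}_i$$ (only indices $1\le j\le r$ occur) with each $\mathcal{F}_i^{[j]}$ locally a direct factor of $\mathcal{E}_i$, of rank $d_i-\delta_j$ if $1\le j\le s(i)-1$ and of rank $h+d_i-\delta_j$ if $s(i)+1\le j\le r$. Set $\mathcal{F}_i^{[s(i)]}:=0$. Define $\widetilde{\mathcal{F}}_i^{[j]}:=V_i^{-1}((\mathcal{F}_{i-1}^{[j]})^{(p)})$ for $1\le j\le s(i-1)$ and $\widetilde{\mathcal{F}}_i^{[j]}:=F_i((\mathcal{F}_{i-1}^{[j]})^{(p)})$ for $s(i-1)+1\le j\le r$. The filtrations are required to satisfy, for all $i$: $\mathcal{F}_i^{[j]}\subset\widetilde{\mathcal{F}}_i^{[j]}$ for $1\le j\le s(i)-1$, and $\widetilde{\mathcal{F}}_i^{[j]}\subset\mathcal{F}_i^{[j]}$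 for $s(i)+1\le j\le r$. Valuations. $h_i^{[j]}$ is the determinant of the natural map $\mathcal{F}_i/\mathcal{F}_i^{[j]}\to\mathcal{E}_i/\widetilde{\mathcal{F}}_i^{[j]}$ if $1\le j\le s(i)$, and of $\widetilde{\mathcal{F}}_i^{[j]}\to\mathcal{F}_i^{[j]}/\mathcal{F}_i$ if $s(i)<j\le r$. Trivializing the invertible sheaf in which it lives, $w_i^{[j]}:=v(h_i^{[j]})\in[0,1]$, where for $x\in O_K/p$ one sets $v(x)=\min(v(\tilde x),1)$ for any lift $\tilde x\in O_K$. *)

theory Defs
  imports
    "HOL-Library.Extended_Real"
    "Jordan_Normal_Form.Determinant"
begin

section \<open>Valued extensions of the p-adic numbers\<close>

definition real_valuation :: "('k::field \<Rightarrow> ereal) \<Rightarrow> bool" where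
  "real_valuation v \<longleftrightarrow>
     v 0 = \<infinity> \<and> (\<forall>x. x \<noteq> 0 \<longrightarrow> (\<exists>t::real. v x = ereal t)) \<and>
     (\<forall>x y. v (x * y) = v x + v y) \<and> (\<forall>x y. min (v x) (v y) \<le> v (x + y))"

definition val_ring :: "('k::field \<Rightarrow> ereal) \<Rightarrow> 'k set" where
  "val_ring v = {x. 0 \<le> v x}"

definition val_Cauchy :: "('k::field \<Rightarrow> ereal) \<Rightarrow> (nat \<Rightarrow> 'k) \<Rightarrow> bool" where
  "val_Cauchy v q \<longleftrightarrow> (\<forall>C::real. \<exists>N. \<forall>m\<ge>N. \<forall>n\<ge>N. ereal C \<le> v (q m - q n))"

definition val_lim :: "('k::field \<Rightarrow> ereal) \<Rightarrow> (nat \<Rightarrow> 'k) \<Rightarrow> 'k \<Rightarrow> bool" where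
  "val_lim v q x \<longleftrightarrow> (\<lambda>n. v (q n - x)) \<longlonglongrightarrow> \<infinity>"

text \<open>A field containing \<open>\<rat>\<^sub>p\<close>, with a valuation such that \<open>v p = 1\<close>. For \<open>p\<close> prime, such a
  valuation restricts to the p-adic valuation on the rationals; \<open>\<rat>\<^sub>p\<close> being their completion,
  containing it means that all Cauchy sequences of rationals converge, and the copy of
  \<open>\<rat>\<^sub>p\<close> is the set \<open>Qp\<close> of their limits.\<close>

definition Qp :: "('k::field_char_0 \<Rightarrow> ereal) \<Rightarrow> 'k set" where
  "Qp v = {x. \<exists>q::nat \<Rightarrow> rat. val_lim v (\<lambda>n. of_rat (q n)) x}"

definition extension_of_Qp :: "nat \<Rightarrow> ('k::field_char_0 \<Rightarrow> ereal) \<Rightarrow> bool" where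
  "extension_of_Qp p v \<longleftrightarrow>
     real_valuation v \<and> v (of_nat p) = 1 \<and>
     (\<forall>q::nat \<Rightarrow> rat. val_Cauchy v (\<lambda>n. of_rat (q n)) \<longrightarrow> (\<exists>x. val_lim v (\<lambda>n. of_rat (q n)) x))"

text \<open>Degree \<open>f\<close> over \<open>\<rat>\<^sub>p\<close>, and \<open>p\<close> is still a uniformizer (the residue extension is
  automatically separable).\<close>

definition unramified_extension :: "nat \<Rightarrow> nat \<Rightarrow> ('l::field_char_0 \<Rightarrow> ereal) \<Rightarrow> bool" where
  "unramified_extension p f v \<longleftrightarrow>
     extension_of_Qp p v \<and>
     (\<exists>b::nat \<Rightarrow> 'l. \<forall>x. \<exists>!c::nat \<Rightarrow> 'l.
        (\<forall>k<f. c k \<in> Qp v) \<and> (\<forall>k\<ge>f. c k = 0) \<and> x = (\<Sum>k<f. c k * b k)) \<and>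
     (\<forall>x. x \<noteq> 0 \<longrightarrow> (\<exists>n::int. v x = ereal (real_of_int n)))"

section \<open>The base\<close>

text \<open>The type \<open>'r\<close> is \<open>O\<^sub>K / p O\<^sub>K\<close>, presented by the reduction map \<open>red\<close>. Its \<open>k\<close>-algebra
  structure is \<open>emb\<close>: as \<open>p = 0\<close> in \<open>'r\<close>, ring homomorphisms from \<open>k = O\<^sub>F / p O\<^sub>F\<close> to \<open>'r\<close> are the
  same as ring homomorphisms from \<open>O\<^sub>F\<close> to \<open>'r\<close>.\<close>

record ('k, 'l, 'r) base_data =
  prm :: nat
  dgr :: nat
  valK :: "'k \<Rightarrow> ereal"
  valF :: "'l \<Rightarrow> ereal"
  red :: "'k \<Rightarrow> 'r"
  emb :: "'l \<Rightarrow> 'r"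

definition ring_hom_on :: "'k::field set \<Rightarrow> ('k \<Rightarrow> 'r::comm_ring_1) \<Rightarrow> bool" where
  "ring_hom_on A g \<longleftrightarrow>
     g 1 = 1 \<and> (\<forall>x\<in>A. \<forall>y\<in>A. g (x + y) = g x + g y \<and> g (x * y) = g x * g y)"

definition admissible_base ::
  "('k::field_char_0, 'l::field_char_0, 'r::comm_ring_1) base_data \<Rightarrow> bool" where
  "admissible_base B \<longleftrightarrow>
     prime (prm B) \<and>
     extension_of_Qp (prm B) (valK B) \<and>
     unramified_extension (prm B) (dgr B) (valF B) \<and>
     ring_hom_on (val_ring (valK B)) (red B) \<and>
     red B ` val_ring (valK B) = UNIV \<and>
     (\<forall>x\<in>val_ring (valK B).
        red B x = 0 \<longleftrightarrow> (\<exists>y\<in>val_ring (valK B). x = of_nat (prm B) * y)) \<and>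
     ring_hom_on (val_ring (valF B)) (emb B)"

definition trunc_val :: "('k::field_char_0, 'l, 'r) base_data \<Rightarrow> 'r \<Rightarrow> real" where
  "trunc_val B x =
     real_of_ereal (min (valK B (SOME y. y \<in> val_ring (valK B) \<and> red B y = x)) 1)"

section \<open>Free modules, direct factors and determinants\<close>

definition free_rank ::
  "('r::comm_ring_1 \<Rightarrow> 'e::ab_group_add \<Rightarrow> 'e) \<Rightarrow> nat \<Rightarrow> 'e set \<Rightarrow> bool" where
  "free_rank s n M \<longleftrightarrow>
     (\<exists>b. finite b \<and> card b = n \<and> \<not> Modules.module.dependent s b \<and> Modules.module.span s b = M)"

text \<open>Over the local ring \<open>O\<^sub>K / p\<close>, being locally a direct factor is being a direct factor, and
  direct factors of free modules of finite rank are free.\<close>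

definition direct_factor ::
  "('r::comm_ring_1 \<Rightarrow> 'e::ab_group_add \<Rightarrow> 'e) \<Rightarrow> nat \<Rightarrow> 'e set \<Rightarrow> 'e set \<Rightarrow> bool" where
  "direct_factor s n M N \<longleftrightarrow>
     free_rank s n M \<and> M \<subseteq> N \<and>
     (\<exists>C. Modules.module.subspace s C \<and> C \<subseteq> N \<and> M \<inter> C = {0} \<and> N = {x + y | x y. x \<in> M \<and> y \<in> C})"

text \<open>The classes of \<open>b 0, \<dots>, b (n - 1)\<close> form a basis of the quotient \<open>M / M'\<close>.\<close>

definition quotient_basis ::
  "('r::comm_ring_1 \<Rightarrow> 'e::ab_group_add \<Rightarrow> 'e) \<Rightarrow> nat \<Rightarrow> 'e set \<Rightarrow> 'e set \<Rightarrow> (nat \<Rightarrow> 'e) \<Rightarrow> bool" where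
  "quotient_basis s n M M' b \<longleftrightarrow>
     (\<forall>k<n. b k \<in> M) \<and>
     (\<forall>x\<in>M. \<exists>!c::nat \<Rightarrow> 'r. (\<forall>k\<ge>n. c k = 0) \<and> x - (\<Sum>k<n. s (c k) (b k)) \<in> M')"

text \<open>For \<open>M \<subseteq> N\<close> and \<open>M' \<subseteq> N'\<close>: \<open>t\<close> is the determinant of the natural map \<open>M / M' \<rightarrow> N / N'\<close> with
  respect to some bases of these two modules, both free of rank \<open>n\<close>. It is determined up
  to a unit.\<close>

definition natural_map_det ::
  "('r::comm_ring_1 \<Rightarrow> 'e::ab_group_add \<Rightarrow> 'e) \<Rightarrow> nat \<Rightarrow> 'e set \<Rightarrow> 'e set \<Rightarrow> 'e set \<Rightarrow> 'e set \<Rightarrow> 'r \<Rightarrow> bool"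
where
  "natural_map_det s n M M' N N' t \<longleftrightarrow>
     (\<exists>b b' m. quotient_basis s n M M' b \<and> quotient_basis s n N N' b' \<and>
        (\<forall>k<n. b k - (\<Sum>l<n. s (m (l, k)) (b' l)) \<in> N') \<and>
        t = Determinant.det (Matrix.mat n n m))"

section \<open>The Dieudonne crystal with its additional structures\<close>

text \<open>\<open>'e\<close> is the module \<open>\<E>\<close> with scalar multiplication \<open>scl\<close>, and \<open>'t\<close> is its Frobenius twist
  \<open>\<E>\<^sup>(\<^sup>p\<^sup>)\<close> with scalar multiplication \<open>scl_tw\<close>; \<open>twi x\<close> is \<open>1 \<otimes> x\<close>. Frobenius and Verschiebung
  are \<open>Frob\<close> and \<open>Ver\<close>, \<open>hodge\<close> is the Hodge filtration \<open>\<omega>\<^sub>G\<close>, and \<open>act\<close> is the action of \<open>O\<^sub>F\<close>.\<close>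

record ('l, 'r, 'e, 't) dieudonne =
  scl :: "'r \<Rightarrow> 'e \<Rightarrow> 'e"
  scl_tw :: "'r \<Rightarrow> 't \<Rightarrow> 't"
  twi :: "'e \<Rightarrow> 't"
  Frob :: "'t \<Rightarrow> 'e"
  Ver :: "'e \<Rightarrow> 't"
  hodge :: "'e set"
  act :: "'l \<Rightarrow> 'e \<Rightarrow> 'e"

text \<open>The base change of a free module along \<open>c \<mapsto> c\<^sup>p\<close>: the semilinear map \<open>\<tau>\<close> takes a basis to
  a basis. This determines \<open>\<tau>\<close> up to a unique isomorphism.\<close>

definition frobenius_twist ::
  "nat \<Rightarrow> ('r::comm_ring_1 \<Rightarrow> 'e::ab_group_add \<Rightarrow> 'e) \<Rightarrow> ('r \<Rightarrow> 't::ab_group_add \<Rightarrow> 't) \<Rightarrow> ('e \<Rightarrow> 't) \<Rightarrow> bool"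
where
  "frobenius_twist p s s' \<tau> \<longleftrightarrow>
     (\<forall>x y. \<tau> (x + y) = \<tau> x + \<tau> y) \<and> (\<forall>c x. \<tau> (s c x) = s' (c ^ p) (\<tau> x)) \<and>
     (\<exists>b. finite b \<and> \<not> Modules.module.dependent s b \<and> Modules.module.span s b = UNIV \<and>
        inj_on \<tau> b \<and> \<not> Modules.module.dependent s' (\<tau> ` b) \<and> Modules.module.span s' (\<tau> ` b) = UNIV)"

text \<open>The image of \<open>M\<^sup>(\<^sup>p\<^sup>)\<close> in \<open>\<E>\<^sup>(\<^sup>p\<^sup>)\<close>; for \<open>M\<close> a direct factor this is \<open>M\<^sup>(\<^sup>p\<^sup>)\<close> itself.\<close>

definition tw :: "('l, 'r::comm_ring_1, 'e::ab_group_add, 't::ab_group_add) dieudonne \<Rightarrow> 'e set \<Rightarrow> 't set" where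
  "tw X M = Modules.module.span (scl_tw X) (twi X ` M)"

text \<open>Indices modulo \<open>f\<close> are represented by \<open>0, \<dots>, f - 1\<close>. On \<open>k\<close>, the \<open>i\<close>-th power of the Frobenius
  is \<open>a \<mapsto> a\<^sup>q\<close> with \<open>q = p\<^sup>i\<close>.\<close>

definition prev_index :: "('k, 'l, 'r) base_data \<Rightarrow> nat \<Rightarrow> nat" where
  "prev_index B i = (i + dgr B - 1) mod dgr B"

definition isotypic ::
  "('k, 'l::field_char_0, 'r::comm_ring_1) base_data \<Rightarrow> ('l, 'r, 'e::ab_group_add, 't) dieudonne \<Rightarrow> nat \<Rightarrow> 'e set"
where
  "isotypic B X i = {x. \<forall>a\<in>val_ring (valF B). act X a x = scl X (emb B a ^ (prm B ^ i)) x}"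

definition hodge_isotypic ::
  "('k, 'l::field_char_0, 'r::comm_ring_1) base_data \<Rightarrow> ('l, 'r, 'e::ab_group_add, 't) dieudonne \<Rightarrow> nat \<Rightarrow> 'e set"
where
  "hodge_isotypic B X i = hodge X \<inter> isotypic B X i"

text \<open>The Dieudonne crystal of a \<open>p\<close>-divisible group with \<open>O\<^sub>F\<close>-action, evaluated at \<open>O\<^sub>K / p\<close>, enters
  only through the following properties: it is the direct sum of its isotypic components, free
  of rank \<open>h\<close>; Frobenius and Verschiebung shift the grading by one; and
  \<open>Ker V\<^sub>i = Im F\<^sub>i\<close>, \<open>Ker F\<^sub>i = Im V\<^sub>i\<close>, the latter being the twisted Hodge filtration. No group
  is constructed: every tuple with these properties is allowed.\<close>

definition dieudonne_module ::
  "('k, 'l::field_char_0, 'r::comm_ring_1) base_data \<Rightarrow> nat \<Rightarrow> (nat \<Rightarrow> nat) \<Rightarrow>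
   ('l, 'r, 'e::ab_group_add, 't::ab_group_add) dieudonne \<Rightarrow> bool"
where
  "dieudonne_module B h d X \<longleftrightarrow>
     Modules.module (scl X) \<and> Modules.module (scl_tw X) \<and>
     frobenius_twist (prm B) (scl X) (scl_tw X) (twi X) \<and>
     Modules.module_hom (scl_tw X) (scl X) (Frob X) \<and>
     Modules.module_hom (scl X) (scl_tw X) (Ver X) \<and>
     (\<forall>a\<in>val_ring (valF B). Modules.module_hom (scl X) (scl X) (act X a)) \<and>
     act X 1 = id \<and>
     (\<forall>a\<in>val_ring (valF B). \<forall>a'\<in>val_ring (valF B).
        act X (a * a') = act X a \<circ> act X a' \<and> (\<forall>x. act X (a + a') x = act X a x + act X a' x)) \<and>
     (\<forall>x. \<exists>!c::nat \<Rightarrow> 'e.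
        (\<forall>i<dgr B. c i \<in> isotypic B X i) \<and> (\<forall>i\<ge>dgr B. c i = 0) \<and> x = (\<Sum>i<dgr B. c i)) \<and>
     (\<forall>i<dgr B. free_rank (scl X) h (isotypic B X i)) \<and>
     Modules.module.subspace (scl X) (hodge X) \<and>
     (\<forall>a\<in>val_ring (valF B). act X a ` hodge X \<subseteq> hodge X) \<and>
     (\<forall>i<dgr B. direct_factor (scl X) (d i) (hodge_isotypic B X i) (isotypic B X i)) \<and>
     (\<forall>i<dgr B. Frob X ` tw X (isotypic B X (prev_index B i)) \<subseteq> isotypic B X i) \<and>
     (\<forall>i<dgr B. Ver X ` isotypic B X i \<subseteq> tw X (isotypic B X (prev_index B i))) \<and>
     (\<forall>i<dgr B. {x \<in> isotypic B X i. Ver X x = 0} = Frob X ` tw X (isotypic B X (prev_index B i))) \<and>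
     (\<forall>i<dgr B. {y \<in> tw X (isotypic B X (prev_index B i)). Frob X y = 0} = Ver X ` isotypic B X i) \<and>
     (\<forall>i<dgr B. Ver X ` isotypic B X i = tw X (hodge_isotypic B X (prev_index B i)))"

definition isomorphic_dieudonne ::
  "('k, 'l::field_char_0, 'r::comm_ring_1) base_data \<Rightarrow>
   ('l, 'r, 'e::ab_group_add, 't::ab_group_add) dieudonne \<Rightarrow>
   ('l, 'r, 'e1::ab_group_add, 't1::ab_group_add) dieudonne \<Rightarrow> bool"
where
  "isomorphic_dieudonne B X Y \<longleftrightarrow>
     (\<exists>g g'. bij g \<and> Modules.module_hom (scl X) (scl Y) g \<and>
        bij g' \<and> Modules.module_hom (scl_tw X) (scl_tw Y) g' \<and>
        (\<forall>x. g' (twi X x) = twi Y (g x)) \<and>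
        (\<forall>a\<in>val_ring (valF B). \<forall>x. g (act X a x) = act Y a (g x)) \<and>
        (\<forall>y. g (Frob X y) = Frob Y (g' y)) \<and> (\<forall>x. g' (Ver X x) = Ver Y (g x)) \<and>
        g ` hodge X = hodge Y)"

section \<open>Adequate filtrations and their valuations\<close>

definition jumps :: "('k, 'l, 'r) base_data \<Rightarrow> nat \<Rightarrow> (nat \<Rightarrow> nat) \<Rightarrow> nat set" where
  "jumps B h d = d ` {..<dgr B} \<inter> {1..<h}"

definition njumps :: "('k, 'l, 'r) base_data \<Rightarrow> nat \<Rightarrow> (nat \<Rightarrow> nat) \<Rightarrow> nat" where
  "njumps B h d = card (jumps B h d)"

definition delta :: "('k, 'l, 'r) base_data \<Rightarrow> nat \<Rightarrow> (nat \<Rightarrow> nat) \<Rightarrow> nat \<Rightarrow> nat" where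
  "delta B h d j =
     (if j = 0 then 0
      else if j \<le> njumps B h d then sorted_list_of_set (jumps B h d) ! (j - 1)
      else h)"

text \<open>\<open>jump_index\<close> is the function \<open>s\<close> with \<open>d i = \<delta> (s i)\<close>.\<close>

definition jump_index :: "('k, 'l, 'r) base_data \<Rightarrow> nat \<Rightarrow> (nat \<Rightarrow> nat) \<Rightarrow> nat \<Rightarrow> nat" where
  "jump_index B h d i = (LEAST j. j \<le> njumps B h d + 1 \<and> delta B h d j = d i)"

definition tilde ::
  "('k, 'l::field_char_0, 'r::comm_ring_1) base_data \<Rightarrow> nat \<Rightarrow> (nat \<Rightarrow> nat) \<Rightarrow>
   ('l, 'r, 'e::ab_group_add, 't::ab_group_add) dieudonne \<Rightarrow>
   (nat \<Rightarrow> nat \<Rightarrow> 'e set) \<Rightarrow> nat \<Rightarrow> nat \<Rightarrow> 'e set"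
where
  "tilde B h d X Fil i j =
     (if j \<le> jump_index B h d (prev_index B i)
      then {x \<in> isotypic B X i. Ver X x \<in> tw X (Fil (prev_index B i) j)}
      else Frob X ` tw X (Fil (prev_index B i) j))"

text \<open>Only the values \<open>Fil i j\<close> with \<open>i < f\<close> and \<open>1 \<le> j \<le> r\<close> are relevant. The convention
  that \<open>Fil i j\<close> vanishes for \<open>j = jump_index B h d i\<close> is part of the definition.\<close>

definition adequate ::
  "('k, 'l::field_char_0, 'r::comm_ring_1) base_data \<Rightarrow> nat \<Rightarrow> (nat \<Rightarrow> nat) \<Rightarrow>
   ('l, 'r, 'e::ab_group_add, 't::ab_group_add) dieudonne \<Rightarrow>
   (nat \<Rightarrow> nat \<Rightarrow> 'e set) \<Rightarrow> bool"
where
  "adequate B h d X Fil \<longleftrightarrow>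
     (\<forall>i<dgr B. \<forall>j\<in>{1..njumps B h d}.
        (j < jump_index B h d i \<longrightarrow>
           direct_factor (scl X) (d i - delta B h d j) (Fil i j) (isotypic B X i) \<and>
           Fil i j \<subseteq> hodge_isotypic B X i \<and>
           (\<forall>j'. j < j' \<and> j' < jump_index B h d i \<longrightarrow> Fil i j' \<subseteq> Fil i j) \<and>
           Fil i j \<subseteq> tilde B h d X Fil i j) \<and>
        (j = jump_index B h d i \<longrightarrow> Fil i j = {0}) \<and>
        (jump_index B h d i < j \<longrightarrow>
           direct_factor (scl X) (h + d i - delta B h d j) (Fil i j) (isotypic B X i) \<and>
           hodge_isotypic B X i \<subseteq> Fil i j \<and>
           (\<forall>j'. j < j' \<and> j' \<le> njumps B h d \<longrightarrow> Fil i j' \<subseteq> Fil i j) \<and>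
           tilde B h d X Fil i j \<subseteq> Fil i j))"

definition adequate_det ::
  "('k, 'l::field_char_0, 'r::comm_ring_1) base_data \<Rightarrow> nat \<Rightarrow> (nat \<Rightarrow> nat) \<Rightarrow>
   ('l, 'r, 'e::ab_group_add, 't::ab_group_add) dieudonne \<Rightarrow>
   (nat \<Rightarrow> nat \<Rightarrow> 'e set) \<Rightarrow> nat \<Rightarrow> nat \<Rightarrow> 'r"
where
  "adequate_det B h d X Fil i j =
     (SOME t.
        if j \<le> jump_index B h d i
        then natural_map_det (scl X) (delta B h d j)
               (hodge_isotypic B X i) (Fil i j) (isotypic B X i) (tilde B h d X Fil i j) t
        else natural_map_det (scl X) (h - delta B h d j)
               (tilde B h d X Fil i j) {0} (Fil i j) (hodge_isotypic B X i) t)"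

definition adequate_val ::
  "('k::field_char_0, 'l::field_char_0, 'r::comm_ring_1) base_data \<Rightarrow> nat \<Rightarrow> (nat \<Rightarrow> nat) \<Rightarrow>
   ('l, 'r, 'e::ab_group_add, 't::ab_group_add) dieudonne \<Rightarrow>
   (nat \<Rightarrow> nat \<Rightarrow> 'e set) \<Rightarrow> nat \<Rightarrow> nat \<Rightarrow> real"
where
  "adequate_val B h d X Fil i j = trunc_val B (adequate_det B h d X Fil i j)"

end

theory Submission
  imports Defs "HOL-Computational_Algebra.Primes"
begin

text \<open>Fix \<open>j\<close>. The valuation \<open>w\<^sub>i\<^sup>[\<^sup>j\<^sup>]\<close> is that of a generator of the Fitting ideal of
  \<open>\<E>\<^sub>i / (\<F>\<^sub>i + N)\<close> (or, if \<open>j > s(i)\<close>, of its dual analogue), where \<open>N\<close> is the module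
  \<open>\<F>\<^sub>i\<^sup>[\<^sup>j\<^sup>]\<close> with a tilde. So it only depends on \<open>N\<close>, hence only on the Frobenius twist of
  \<open>\<F>\<^sub>i\<^sub>-\<^sub>1\<^sup>[\<^sup>j\<^sup>]\<close>. Given \<open>N\<close>, Cramer's rule determines \<open>\<F>\<^sub>i\<^sup>[\<^sup>j\<^sup>]\<close> up to the annihilator of the
  determinant. This annihilator consists of elements of valuation at least \<open>1 - w\<^sub>i\<^sup>[\<^sup>j\<^sup>] > 1 / 2\<close>,
  whose \<open>p\<close>-th powers vanish modulo \<open>p\<close>; so the twist of \<open>\<F>\<^sub>i\<^sup>[\<^sup>j\<^sup>]\<close> is determined exactly. As
  \<open>\<F>\<^sub>i\<^sup>[\<^sup>j\<^sup>] = 0\<close> for any \<open>i\<close> with \<open>d\<^sub>i = \<delta>\<^sub>j\<close>, induction around the cycle \<open>\<int> / f\<int>\<close> shows that all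
  these twists are independent of the filtration.\<close>

section \<open>The truncated valuation\<close>

text \<open>Two adequate filtrations may differ; only their twists are shown to agree. This suffices
  because a member of the filtration enters the next index only through its twist, so an error whose
  coefficients satisfy \<open>c ^ p = 0\<close> is erased before it can propagate. The error is
  controlled from one side only, and the side depends on the case. If \<open>j \<le> s(i)\<close>,
  the second filtration maps into the kernel of the natural map of the first, hence lies in the
  first up to coefficients killed by the determinant. Otherwise multiplication by the determinant
  carries the first filtration into the second. Equality of the twists then comes from equality of
  ranks. That last step needs rank arguments over \<open>O_K / p\<close>, a local ring that may have
  nilpotents, and twists along a Frobenius that need not be flat. Both obstacles are met by working
  with submodules split by linear functionals on the whole ambient module: over a local ring such
  functionals produce unit pivots, and they survive base change. The size bound concerns the first
  filtration alone, so every estimate uses its determinant.\<close>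

lemma val_basics:
  assumes "real_valuation v"
  shows val_zero: "v 0 = \<infinity>" and val_mult: "v (x * y) = v x + v y"
    and val_add: "min (v x) (v y) \<le> v (x + y)"
    and val_one: "v 1 = 0" and val_minus: "v (- x) = v x"
    and val_not_MInf: "v x \<noteq> -\<infinity>"
proof -
  show "v 0 = \<infinity>" and m: "v (x * y) = v x + v y" and "min (v x) (v y) \<le> v (x + y)" for x y
    using assms by (auto simp: real_valuation_def)
  have fin: "x \<noteq> 0 \<Longrightarrow> \<exists>t::real. v x = ereal t" for x
    using assms by (auto simp: real_valuation_def)
  obtain a where a: "v 1 = ereal a" using fin[of 1] by auto
  show one: "v 1 = 0" using m[of 1 1] a by (simp add: zero_ereal_def)
  obtain c where c: "v (-1) = ereal c" using fin[of "-1"] by auto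
  have "v (-1) = 0" using m[of "-1" "-1"] c one by (simp add: zero_ereal_def)
  then show "v (- x) = v x" using m[of "-1" x] by simp
  show "v x \<noteq> -\<infinity>" using fin[of x] \<open>v 0 = \<infinity>\<close> by (cases "x = 0") auto
qed

context
  fixes B :: "('k::field_char_0, 'l::field_char_0, 'r::comm_ring_1) base_data"
  assumes B: "admissible_base B"
begin

lemma base_valuation: "real_valuation (valK B)"
  using B by (auto simp: admissible_base_def extension_of_Qp_def)

lemmas vK = val_zero[OF base_valuation] val_mult[OF base_valuation] val_add[OF base_valuation]
  val_one[OF base_valuation] val_minus[OF base_valuation] val_not_MInf[OF base_valuation]

lemma base_prime: "prime (prm B)"
  using B by (auto simp: admissible_base_def)

lemma val_prm: "valK B (of_nat (prm B)) = 1"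
  using B by (auto simp: admissible_base_def extension_of_Qp_def)

lemma red_one: "red B 1 = 1"
  and red_add: "0 \<le> valK B x \<Longrightarrow> 0 \<le> valK B y \<Longrightarrow> red B (x + y) = red B x + red B y"
  and red_mult: "0 \<le> valK B x \<Longrightarrow> 0 \<le> valK B y \<Longrightarrow> red B (x * y) = red B x * red B y"
  using B by (auto simp: admissible_base_def ring_hom_on_def val_ring_def)

lemma val_add_nonneg: "0 \<le> valK B x \<Longrightarrow> 0 \<le> valK B y \<Longrightarrow> 0 \<le> valK B (x + y)"
  using vK(3)[of x y] by (meson min.boundedI order_trans)

lemma red_eq_0_iff:
  assumes "0 \<le> valK B x"
  shows "red B x = 0 \<longleftrightarrow> 1 \<le> valK B x"
proof
  assume "red B x = 0"
  then obtain y where "0 \<le> valK B y" "x = of_nat (prm B) * y"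
    using B assms by (auto simp: admissible_base_def val_ring_def)
  then show "1 \<le> valK B x" by (simp add: vK val_prm add_increasing2)
next
  assume le: "1 \<le> valK B x"
  let ?y = "x / of_nat (prm B)"
  have ne: "(of_nat (prm B) :: 'k) \<noteq> 0" using base_prime by (auto simp: prime_nat_iff)
  then have x: "x = of_nat (prm B) * ?y" by simp
  have "1 \<le> 1 + valK B ?y" using le x vK(2)[of "of_nat (prm B)" ?y] by (simp add: val_prm)
  then have "0 \<le> valK B ?y" by (cases "valK B ?y") auto
  then show "red B x = 0" using B assms x by (auto simp: admissible_base_def val_ring_def)
qed

lemma red_zero: "red B 0 = 0"
  by (simp add: red_eq_0_iff vK)

lemma red_minus: "0 \<le> valK B x \<Longrightarrow> red B (- x) = - red B x"
  using red_add[of x "- x"] by (simp add: vK red_zero add_eq_0_iff)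

lemma red_eq_iff:
  assumes "0 \<le> valK B x" "0 \<le> valK B y"
  shows "red B x = red B y \<longleftrightarrow> 1 \<le> valK B (x - y)"
proof -
  have "0 \<le> valK B (- y)" using assms by (simp add: vK)
  then show ?thesis
    using red_eq_0_iff[of "x + - y"] val_add_nonneg[of x "- y"] assms red_add[of x "- y"] red_minus[of y]
    by simp
qed

lemma obtain_lift:
  obtains y where "0 \<le> valK B y" "red B y = x"
    "trunc_val B x = real_of_ereal (min (valK B y) 1)"
proof -
  let ?P = "\<lambda>y. y \<in> val_ring (valK B) \<and> red B y = x"
  have "x \<in> red B ` val_ring (valK B)" using B by (auto simp: admissible_base_def)
  then have "\<exists>y. ?P y" by auto
  then have "?P (SOME y. ?P y)" by (rule someI_ex)
  then show ?thesis using that[of "SOME y. ?P y"] by (simp add: trunc_val_def val_ring_def)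
qed

lemma trunc_val_nonneg: "0 \<le> trunc_val B x"
  by (rule obtain_lift[of x]) (auto simp: real_of_ereal_pos)

text \<open>Any two lifts differ by an element of valuation at least \<open>1\<close>, which
  truncation hides, so the lift chosen by \<open>SOME\<close> does not matter. In particular
  associated elements have equal truncated valuation, which makes the valuation of a determinant
  independent of bases.\<close>

lemma trunc_val_dvd_mono:
  assumes "x dvd y"
  shows "trunc_val B x \<le> trunc_val B y"
proof -
  obtain z where y: "y = x * z" using assms by auto
  obtain x' where x': "0 \<le> valK B x'" "red B x' = x"
      "trunc_val B x = real_of_ereal (min (valK B x') 1)" by (rule obtain_lift)
  obtain y' where y': "0 \<le> valK B y'" "red B y' = y"
      "trunc_val B y = real_of_ereal (min (valK B y') 1)" by (rule obtain_lift)
  obtain z' where z': "0 \<le> valK B z'" "red B z' = z" by (rule obtain_lift)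
  have "red B y' = red B (x' * z')" using x' y' z' y by (simp add: red_mult)
  then have "1 \<le> valK B (y' - x' * z')" using red_eq_iff x' y' z' by (simp add: vK)
  moreover have "valK B x' \<le> valK B (x' * z')" using z' by (simp add: vK add_increasing2)
  ultimately have "min (valK B x') 1 \<le> min (valK B (x' * z')) (valK B (y' - x' * z'))"
    by (simp add: min.coboundedI1 min.coboundedI2)
  also have "\<dots> \<le> valK B y'" using vK(3)[of "x' * z'" "y' - x' * z'"] by simp
  finally have "min (valK B x') 1 \<le> min (valK B y') 1" by simp
  moreover have "0 \<le> min (valK B x') 1" using x' by simp
  moreover have "min (valK B y') 1 \<noteq> \<infinity>" by (auto simp: min_def)
  ultimately show ?thesis unfolding x'(3) y'(3) by (intro real_of_ereal_positive_mono)
qed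

text \<open>This is where the bound \<open>1 / 2\<close> enters: the annihilator of an element of valuation less than
  \<open>1 / 2\<close> is killed by Frobenius, since \<open>p \<ge> 2\<close>.\<close>

lemma power_eq_0_if_annihilates:
  assumes t: "trunc_val B t < 1 / 2" and xt: "x * t = 0"
  shows "x ^ prm B = 0"
proof -
  obtain x' where x': "0 \<le> valK B x'" "red B x' = x" by (rule obtain_lift)
  obtain t' where t': "0 \<le> valK B t'" "red B t' = t"
      "trunc_val B t = real_of_ereal (min (valK B t') 1)" by (rule obtain_lift)
  have "1 \<le> valK B (x' * t')"
    using xt x' t' red_eq_0_iff[of "x' * t'"] by (simp add: red_mult vK)
  moreover have "valK B t' < ereal (1/2)"
    using t t' by (cases "valK B t'") (auto simp: min_def split: if_splits)
  ultimately have "ereal (1/2) \<le> valK B x'" using x'(1) t'(1)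
    by (cases "valK B x'"; cases "valK B t'") (auto simp: vK)
  then have "1 \<le> valK B (x' * x')"
    by (cases "valK B x'") (auto simp: vK)
  then have "red B (x' * x') = 0" using x' by (simp add: red_eq_0_iff vK)
  then have x2: "x ^ 2 = 0" using x' by (simp add: red_mult power2_eq_square)
  have "2 \<le> prm B" using base_prime by (rule prime_ge_2_nat)
  then obtain n where "prm B = 2 + n" using le_Suc_ex by blast
  then have "x ^ prm B = x ^ 2 * x ^ n" by (simp only: power_add)
  then show ?thesis by (simp only: x2 mult_zero_left)
qed

text \<open>An element is a unit as soon as it has a lift of valuation \<open>0\<close>, and a sum
  of two elements of positive valuation has positive valuation. Locality is what later supplies
  invertible pivots.\<close>

lemma base_local:
  assumes "(x + y :: 'r) dvd 1"
  shows "x dvd 1 \<or> y dvd 1"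
proof -
  have unit: "red B u dvd 1" if "valK B u = 0" for u
  proof -
    have "u \<noteq> 0" using that vK(1) by auto
    then have "u * inverse u = 1" by simp
    moreover have "valK B (inverse u) = 0"
      using calculation that vK(2)[of u "inverse u"] vK(4) by simp
    ultimately show ?thesis using that red_mult[of u "inverse u"] red_one by (metis dvdI order_refl)
  qed
  obtain x' where x': "0 \<le> valK B x'" "red B x' = x" by (rule obtain_lift)
  obtain y' where y': "0 \<le> valK B y'" "red B y' = y" by (rule obtain_lift)
  obtain z where z: "1 = (x + y) * z" using assms by auto
  obtain z' where z': "0 \<le> valK B z'" "red B z' = z" by (rule obtain_lift)
  have "red B ((x' + y') * z') = red B 1"
    using x' y' z' z by (simp add: red_mult red_add red_one val_add_nonneg)
  then have *: "1 \<le> valK B ((x' + y') * z' - 1)"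
    using red_eq_iff[of "(x' + y') * z'" 1] x' y' z' val_add_nonneg[of x' y'] by (simp add: vK)
  \<comment> \<open>\<open>1\<close> is the product minus an element of valuation at least
    \<open>1\<close>, so the ultrametric inequality forces the product to have valuation at most
    \<open>0\<close>.\<close>
  have "min (valK B ((x' + y') * z')) (valK B ((x' + y') * z' - 1)) \<le> 0"
    using vK(3)[of "(x' + y') * z'" "- ((x' + y') * z' - 1)"] unfolding vK(5) by (simp add: vK(4))
  then have "valK B ((x' + y') * z') \<le> 0"
    using order_trans[OF *, of 0] by (auto simp: min_le_iff_disj)
  moreover have "valK B (x' + y') \<le> valK B ((x' + y') * z')"
    using z' by (simp only: vK(2)) (simp add: add_increasing2)
  ultimately have "min (valK B x') (valK B y') \<le> 0" using vK(3)[of x' y'] order_trans by blast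
  then have "valK B x' = 0 \<or> valK B y' = 0" using x' y' by (auto simp: min_le_iff_disj)
  then show ?thesis using unit x' y' by blast
qed

text \<open>The prime \<open>p\<close> reduces to \<open>0\<close> and the ring is nontrivial, so
  the characteristic is a divisor of \<open>p\<close> other than \<open>1\<close>. This makes the
  \<open>p\<close>-th power additive on coefficients.\<close>

lemma base_char: "CHAR('r) = prm B"
proof (rule CHAR_eqI)
  have "of_nat n = red B (of_nat n) \<and> 0 \<le> valK B (of_nat n)" for n
    by (induction n) (auto simp: red_zero vK red_add red_one val_add_nonneg)
  then have *: "(of_nat (prm B) :: 'r) = 0" by (simp add: red_eq_0_iff val_prm)
  then show "(of_nat (prm B) :: 'r) = 0" .
  fix n :: nat assume n: "(of_nat n :: 'r) = 0"
  show "prm B dvd n"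
  proof -
    have "CHAR('r) dvd prm B" using * by (simp add: of_nat_eq_0_iff_char_dvd)
    moreover have "CHAR('r) \<noteq> 1"
      using of_nat_CHAR[where 'a='r] by (metis of_nat_1 one_neq_zero)
    ultimately have "CHAR('r) = prm B"
      using base_prime by (auto simp: prime_nat_iff)
    then show ?thesis using n by (simp add: of_nat_eq_0_iff_char_dvd)
  qed
qed

lemma power_prm_sum: "(\<Sum>i\<in>A. f i :: 'r) ^ prm B = (\<Sum>i\<in>A. f i ^ prm B)"
  using base_char base_prime by (intro freshmans_dream_sum) simp_all

end

section \<open>Bases of quotients\<close>

lemma sum_lessThan_add: "(\<Sum>k<m + n. f k) = (\<Sum>k<m. f k) + (\<Sum>k<n. f (m + k))"
  for f :: "nat \<Rightarrow> 'a::comm_monoid_add"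
  by (induction n) (simp_all add: add.assoc)

lemma module_mult: "Modules.module ((*) :: 'r::comm_ring_1 \<Rightarrow> 'r \<Rightarrow> 'r)"
  by unfold_locales (simp_all add: algebra_simps)

text \<open>The functionals \<open>\<phi>\<close> dual to the basis \<open>b\<close> of \<open>M / M'\<close> are defined on the whole ambient
  module, so their existence expresses that \<open>M / M'\<close> is a direct factor of the quotient by \<open>M'\<close>.\<close>

definition split_basis ::
  "('r::comm_ring_1 \<Rightarrow> 'e::ab_group_add \<Rightarrow> 'e) \<Rightarrow> nat \<Rightarrow> 'e set \<Rightarrow> 'e set \<Rightarrow>
   (nat \<Rightarrow> 'e) \<Rightarrow> (nat \<Rightarrow> 'e \<Rightarrow> 'r) \<Rightarrow> bool"
where
  "split_basis s n M M' b \<phi> \<longleftrightarrow>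
     (\<forall>k<n. b k \<in> M \<and> Modules.module_hom s (*) (\<phi> k) \<and> (\<forall>x\<in>M'. \<phi> k x = 0) \<and>
        (\<forall>l<n. \<phi> k (b l) = (if k = l then 1 else 0))) \<and>
     (\<forall>x\<in>M. x - (\<Sum>k<n. s (\<phi> k x) (b k)) \<in> M')"

lemma split_basisD:
  assumes "split_basis s n M M' b \<phi>"
  shows "k < n \<Longrightarrow> b k \<in> M" "k < n \<Longrightarrow> Modules.module_hom s (*) (\<phi> k)"
    "k < n \<Longrightarrow> x \<in> M' \<Longrightarrow> \<phi> k x = 0" "k < n \<Longrightarrow> l < n \<Longrightarrow> \<phi> k (b l) = (if k = l then 1 else 0)"
    "x \<in> M \<Longrightarrow> x - (\<Sum>k<n. s (\<phi> k x) (b k)) \<in> M'"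
  using assms by (auto simp: split_basis_def)

lemma split_basis_coeff:
  assumes "split_basis s n M M' b \<phi>" "k < n"
  shows "\<phi> k (\<Sum>l<n. s (c l) (b l)) = c k"
proof -
  interpret \<phi>: Modules.module_hom s "(*)" "\<phi> k" using split_basisD(2)[OF assms] .
  have "\<phi> k (\<Sum>l<n. s (c l) (b l)) = (\<Sum>l<n. if k = l then c l else 0)"
    unfolding \<phi>.sum \<phi>.scale
    by (intro sum.cong refl) (use split_basisD(4)[OF assms] in simp)
  then show ?thesis using assms(2) by simp
qed

lemma split_basis_reindex:
  assumes "split_basis s n M M' b \<phi>" "bij_betw \<pi> {..<n} {..<n}"
  shows "split_basis s n M M' (b \<circ> \<pi>) (\<phi> \<circ> \<pi>)"
proof -
  have lt: "k < n \<Longrightarrow> \<pi> k < n" for k using assms(2) by (auto simp: bij_betw_def)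
  have inj: "k < n \<Longrightarrow> l < n \<Longrightarrow> \<pi> k = \<pi> l \<longleftrightarrow> k = l" for k l
    using assms(2) by (auto simp: bij_betw_def inj_on_eq_iff)
  have "(\<Sum>k<n. s (\<phi> (\<pi> k) x) (b (\<pi> k))) = (\<Sum>k<n. s (\<phi> k x) (b k))" for x
    using sum.reindex_bij_betw[OF assms(2)] .
  then show ?thesis using assms(1) lt inj by (auto simp: split_basis_def)
qed

lemma sum_dvd_1:
  fixes f :: "'i \<Rightarrow> 'r::comm_ring_1"
  assumes loc: "\<And>x y :: 'r. x + y dvd 1 \<Longrightarrow> x dvd 1 \<or> y dvd 1"
    and "finite A" "sum f A dvd 1"
  shows "\<exists>a\<in>A. f a dvd 1"
  using assms(2,3) by (induction) (auto dest: loc)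

lemma ex1_unique: "\<exists>!x. P x \<Longrightarrow> P x \<Longrightarrow> P y \<Longrightarrow> x = y"
  by blast

context Modules.module
begin

lemma quotient_basisD:
  assumes "quotient_basis scale n M M' b"
  shows "k < n \<Longrightarrow> b k \<in> M"
    and "x \<in> M \<Longrightarrow> \<exists>c. x - (\<Sum>k<n. c k *s b k) \<in> M'"
  using assms unfolding quotient_basis_def by auto

lemma quotient_basis_indep:
  assumes "quotient_basis scale n M M' b" "0 \<in> M" "0 \<in> M'"
    and "(\<Sum>k<n. c k *s b k) \<in> M'" "k < n"
  shows "c k = 0"
proof -
  have ex1: "\<exists>!c::nat \<Rightarrow> 'a. (\<forall>k\<ge>n. c k = 0) \<and> 0 - (\<Sum>k<n. c k *s b k) \<in> M'"
    using assms(1,2) unfolding quotient_basis_def by blast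
  \<comment> \<open>Both this function and zero represent the vector \<open>0\<close> of
    \<open>M\<close> modulo \<open>M'\<close>. Extending by zero from \<open>n\<close> on puts it in
    the range where coefficients are unique.\<close>
  let ?c = "\<lambda>k. if k < n then - c k else 0"
  have "0 - (\<Sum>k<n. ?c k *s b k) = (\<Sum>k<n. c k *s b k)"
    by (simp add: sum_negf)
  then have "?c = (\<lambda>k. 0)"
    using assms(3,4) by (intro ex1_unique[OF ex1]) simp_all
  then show ?thesis using assms(5) by (metis neg_equal_0_iff_equal)
qed

lemma quotient_basisI:
  assumes "subspace M'" "\<And>k. k < n \<Longrightarrow> b k \<in> M"
    and ex: "\<And>x. x \<in> M \<Longrightarrow> \<exists>c. x - (\<Sum>k<n. c k *s b k) \<in> M'"
    and ind: "\<And>c k. (\<Sum>k<n. c k *s b k) \<in> M' \<Longrightarrow> k < n \<Longrightarrow> c k = 0"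
  shows "quotient_basis scale n M M' b"
  unfolding quotient_basis_def
proof (intro conjI ballI allI impI)
  fix x assume "x \<in> M"
  then obtain c where c: "x - (\<Sum>k<n. c k *s b k) \<in> M'" using ex by blast
  show "\<exists>!c. (\<forall>k\<ge>n. c k = 0) \<and> x - (\<Sum>k<n. c k *s b k) \<in> M'"
  proof (rule ex1I[of _ "\<lambda>k. if k < n then c k else 0"])
    show "(\<forall>k\<ge>n. (if k < n then c k else 0) = 0) \<and> x - (\<Sum>k<n. (if k < n then c k else 0) *s b k) \<in> M'"
      using c by simp
  next
    fix c' assume c': "(\<forall>k\<ge>n. c' k = 0) \<and> x - (\<Sum>k<n. c' k *s b k) \<in> M'"
    have "(x - (\<Sum>k<n. c k *s b k)) - (x - (\<Sum>k<n. c' k *s b k)) \<in> M'"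
      by (rule subspace_diff[OF assms(1) c]) (use c' in blast)
    then have "(\<Sum>k<n. (c' k - c k) *s b k) \<in> M'"
      by (simp add: scale_left_diff_distrib sum_subtractf)
    from ind[OF this] have "k < n \<Longrightarrow> c' k = c k" for k by auto
    then show "c' = (\<lambda>k. if k < n then c k else 0)" using c' by auto
  qed
qed (use assms(2) in auto)

lemma split_basis_imp_quotient_basis:
  assumes "split_basis scale n M M' b \<phi>" "subspace M'"
  shows "quotient_basis scale n M M' b"
proof (rule quotient_basisI)
  fix c k assume "(\<Sum>k<n. c k *s b k) \<in> M'" "k < n"
  then show "c k = 0" using split_basisD(3)[OF assms(1)] split_basis_coeff[OF assms(1)] by metis
next
  fix x assume "x \<in> M"
  then show "\<exists>c. x - (\<Sum>k<n. c k *s b k) \<in> M'"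
    by (intro exI[of _ "\<lambda>k. \<phi> k x"] split_basisD(5)[OF assms(1)])
qed (use assms split_basisD[OF assms(1)] in blast)+

text \<open>Extension of \<open>M / M'\<close> by \<open>M' / M''\<close>. It serves to count ranks
  across the image of Frobenius, which sits between the pieces understood through Verschiebung and
  those understood through Frobenius.\<close>

lemma quotient_basis_concat:
  assumes b: "quotient_basis scale m M M' b" and b': "quotient_basis scale n M' M'' b'"
    and sub: "subspace M'" "subspace M''" "M'' \<subseteq> M'" "M' \<subseteq> M"
  shows "quotient_basis scale (m + n) M M'' (\<lambda>k. if k < m then b k else b' (k - m))"
    (is "quotient_basis scale _ _ _ ?b")
proof (rule quotient_basisI)
  have split: "(\<Sum>k<m + n. c k *s ?b k) = (\<Sum>k<m. c k *s b k) + (\<Sum>k<n. c (m + k) *s b' k)" for c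
    by (simp add: sum_lessThan_add)
  have 0: "0 \<in> M" "0 \<in> M'" "0 \<in> M''" using sub subspace_0 by auto
  fix x assume "x \<in> M"
  then obtain c where c: "x - (\<Sum>k<m. c k *s b k) \<in> M'" using quotient_basisD[OF b] by blast
  then obtain c' where c': "x - (\<Sum>k<m. c k *s b k) - (\<Sum>k<n. c' k *s b' k) \<in> M''"
    using quotient_basisD[OF b'] by blast
  then show "\<exists>c. x - (\<Sum>k<m + n. c k *s ?b k) \<in> M''"
    unfolding split by (intro exI[of _ "\<lambda>k. if k < m then c k else c' (k - m)"]) (simp add: algebra_simps)
next
  have split: "(\<Sum>k<m + n. c k *s ?b k) = (\<Sum>k<m. c k *s b k) + (\<Sum>k<n. c (m + k) *s b' k)" for c
    by (simp add: sum_lessThan_add)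
  have 0: "0 \<in> M" "0 \<in> M'" "0 \<in> M''" using sub subspace_0 by auto
  fix c k assume c: "(\<Sum>k<m + n. c k *s ?b k) \<in> M''" and k: "k < m + n"
  have M': "(\<Sum>k<n. c (m + k) *s b' k) \<in> M'"
    using quotient_basisD[OF b'] sub by (intro subspace_sum subspace_scale) auto
  have "(\<Sum>k<m. c k *s b k) + (\<Sum>k<n. c (m + k) *s b' k) - (\<Sum>k<n. c (m + k) *s b' k) \<in> M'"
    using c sub M' unfolding split by (intro subspace_diff) auto
  then have "(\<Sum>k<m. c k *s b k) \<in> M'" by simp
  then have 1: "c l = 0" if "l < m" for l using quotient_basis_indep[OF b 0(1,2)] that by blast
  then have "(\<Sum>k<n. c (m + k) *s b' k) \<in> M''" using c unfolding split by simp
  then have 2: "c (m + l) = 0" if "l < n" for l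
    using quotient_basis_indep[OF b' 0(2,3), of "\<lambda>k. c (m + k)"] that by blast
  show "c k = 0" using 1[of k] 2[of "k - m"] k by (cases "k < m") auto
qed (use sub quotient_basisD[OF b] quotient_basisD[OF b'] in auto)

end

section \<open>Quotient bases under linear maps\<close>

context Modules.module_hom
begin

text \<open>Surjectivity onto \<open>N\<close> makes the induced map of quotients an isomorphism.
  Applied to Verschiebung, which maps onto the twisted Hodge filtration.\<close>

lemma quotient_basis_pullback:
  assumes b: "quotient_basis s2 n N N' b" and sub: "m1.subspace M" "m2.subspace N'"
    and im: "f ` M = N" and "N' \<subseteq> N"
  shows "\<exists>b'. quotient_basis s1 n M {x \<in> M. f x \<in> N'} b'"
proof -
  have "\<exists>y. y \<in> M \<and> f y = b k" if "k < n" for k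
    using that m2.quotient_basisD(1)[OF b] im by (metis imageE)
  then obtain b' where b': "k < n \<Longrightarrow> b' k \<in> M \<and> f (b' k) = b k" for k by metis
  have fs: "f (\<Sum>k<n. s1 (c k) (b' k)) = (\<Sum>k<n. s2 (c k) (b k))" for c
    unfolding sum scale using b' by simp
  have inM: "(\<Sum>k<n. s1 (c k) (b' k)) \<in> M" for c
    using b' sub by (intro m1.subspace_sum m1.subspace_scale) auto
  have "quotient_basis s1 n M {x \<in> M. f x \<in> N'} b'"
  proof (rule m1.quotient_basisI)
    show "m1.subspace {x \<in> M. f x \<in> N'}"
      using m1.subspace_inter[OF sub(1) subspace_linear_preimage[OF sub(2)]] by (simp add: Int_def)
  next
    fix x assume x: "x \<in> M"
    then obtain c where "f x - (\<Sum>k<n. s2 (c k) (b k)) \<in> N'"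
      using m2.quotient_basisD(2)[OF b] im by blast
    then show "\<exists>c. x - (\<Sum>k<n. s1 (c k) (b' k)) \<in> {x \<in> M. f x \<in> N'}"
      using x inM m1.subspace_diff[OF sub(1)] by (intro exI[of _ c]) (simp add: diff fs)
  next
    fix c k assume "(\<Sum>k<n. s1 (c k) (b' k)) \<in> {x \<in> M. f x \<in> N'}" "k < n"
    moreover have "0 \<in> N" "0 \<in> N'" using sub(2) assms(5) m2.subspace_0 by auto
    ultimately show "c k = 0" using m2.quotient_basis_indep[OF b, of c k] by (simp add: fs)
  qed (use b' in auto)
  then show ?thesis by blast
qed

text \<open>A kernel contained in \<open>M'\<close> makes the induced map of quotients an
  isomorphism. Applied to Frobenius, whose kernel is the twisted Hodge filtration.\<close>

lemma quotient_basis_image: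
  assumes b: "quotient_basis s1 n M M' b" and sub: "m1.subspace M" "m1.subspace M'" "M' \<subseteq> M"
    and ker: "{x \<in> M. f x = 0} \<subseteq> M'"
  shows "quotient_basis s2 n (f ` M) (f ` M') (f \<circ> b)"
proof (rule m2.quotient_basisI)
  have fs: "(\<Sum>k<n. s2 (c k) ((f \<circ> b) k)) = f (\<Sum>k<n. s1 (c k) (b k))" for c
    by (simp add: sum scale)
  show "m2.subspace (f ` M')" using sub(2) by (rule subspace_image)
  show "\<exists>c. y - (\<Sum>k<n. s2 (c k) ((f \<circ> b) k)) \<in> f ` M'" if y: "y \<in> f ` M" for y
  proof -
    obtain x where x: "x \<in> M" "y = f x" using y by blast
    obtain c where "x - (\<Sum>k<n. s1 (c k) (b k)) \<in> M'" using m1.quotient_basisD(2)[OF b x(1)] by blast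
    then show ?thesis unfolding fs x(2) diff[symmetric] by blast
  qed
  show "c k = 0" if c: "(\<Sum>k<n. s2 (c k) ((f \<circ> b) k)) \<in> f ` M'" and k: "k < n" for c k
  proof -
    obtain y where y: "y \<in> M'" "f (\<Sum>k<n. s1 (c k) (b k)) = f y" using c unfolding fs by blast
    have M: "(\<Sum>k<n. s1 (c k) (b k)) \<in> M"
      using m1.quotient_basisD(1)[OF b] sub by (intro m1.subspace_sum m1.subspace_scale) auto
    have "f ((\<Sum>k<n. s1 (c k) (b k)) - y) = 0" by (simp only: diff y(2) diff_self)
    moreover have "(\<Sum>k<n. s1 (c k) (b k)) - y \<in> M"
      by (rule m1.subspace_diff[OF sub(1) M]) (use y sub in blast)
    ultimately have "(\<Sum>k<n. s1 (c k) (b k)) - y \<in> M'" using ker by blast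
    then have "(\<Sum>k<n. s1 (c k) (b k)) \<in> M'" using y m1.subspace_add[OF sub(2)] by fastforce
    moreover have "0 \<in> M" "0 \<in> M'" using sub m1.subspace_0 by auto
    ultimately show ?thesis using m1.quotient_basis_indep[OF b] k by blast
  qed
qed (use m1.quotient_basisD(1)[OF b] in auto)

end

section \<open>Direct factors over a local ring\<close>

context Modules.module
begin

lemma functional_sub_scaled:
  assumes "Modules.module_hom scale (*) \<phi>" "Modules.module_hom scale (*) \<psi>"
  shows "Modules.module_hom scale (*) (\<lambda>x. \<phi> x - c * \<psi> x)"
proof -
  interpret P: Modules.module_pair scale "(*)"
    by (intro Modules.module_pair.intro module_mult) unfold_locales
  show ?thesis using assms by (intro P.module_hom_sub P.module_hom_scale)
qed

text \<open>Steinitz exchange with a unit coordinate in place of a nonzero one: the vector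
  \<open>e j\<close> is traded for \<open>\<beta>\<close>, which moves into the submodule.\<close>

lemma split_basis_exchange:
  assumes e: "split_basis scale (Suc n) N M e \<psi>" and M: "subspace M"
    and \<beta>: "\<beta> \<in> N" and j: "j < Suc n" and unit: "\<psi> j \<beta> dvd 1"
  shows "\<exists>e' \<psi>'. split_basis scale n N (span (insert \<beta> M)) e' \<psi>'"
proof -
  let ?\<pi> = "Transposition.transpose j n"
  have bij: "bij_betw ?\<pi> {..<Suc n} {..<Suc n}"
    using j by (auto intro!: bij_betw_byWitness[where f' = ?\<pi>] simp: Transposition.transpose_def)
  define e1 \<psi>1 where "e1 = e \<circ> ?\<pi>" and "\<psi>1 = \<psi> \<circ> ?\<pi>"
  have e1: "split_basis scale (Suc n) N M e1 \<psi>1"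
    unfolding e1_def \<psi>1_def by (rule split_basis_reindex[OF e bij])
  have "\<psi>1 n \<beta> dvd 1" using unit by (simp add: \<psi>1_def)
  then obtain u where u: "\<psi>1 n \<beta> * u = 1" by (metis dvdE)
  \<comment> \<open>\<open>u\<close> inverts the pivot, so this row operation makes the functionals
    vanish at \<open>\<beta>\<close>. They stay dual to the first \<open>n\<close> vectors because
    \<open>\<psi>1 n\<close> vanishes on those.\<close>
  define \<psi>' where "\<psi>' k x = \<psi>1 k x - (\<psi>1 k \<beta> * u) * \<psi>1 n x" for k x
  have "split_basis scale n N (span (insert \<beta> M)) e1 \<psi>'"
    unfolding split_basis_def
  proof (intro conjI allI impI ballI)
    fix k assume k: "k < n"
    show "e1 k \<in> N" using split_basisD(1)[OF e1] k by simp
    show hom: "Modules.module_hom scale (*) (\<psi>' k)"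
      unfolding \<psi>'_def using split_basisD(2)[OF e1] k by (intro functional_sub_scaled) auto
    have "\<psi>' k \<beta> = \<psi>1 k \<beta> * (1 - \<psi>1 n \<beta> * u)" by (simp add: \<psi>'_def algebra_simps)
    then have zero: "\<psi>' k \<beta> = 0" by (simp add: u)
    interpret \<psi>': Modules.module_hom scale "(*)" "\<psi>' k" by (rule hom)
    show "\<psi>' k x = 0" if x: "x \<in> span (insert \<beta> M)" for x
    proof -
      obtain a where "x - a *s \<beta> \<in> span M" using x by (auto simp: span_breakdown_eq)
      then have a: "x - a *s \<beta> \<in> M" using M span_eq_iff by metis
      note zero
      moreover have "\<psi>' k (x - a *s \<beta>) = 0" using split_basisD(3)[OF e1 _ a] k by (simp add: \<psi>'_def)
      ultimately show ?thesis by (simp add: \<psi>'.diff \<psi>'.scale)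
    qed
    show "\<psi>' k (e1 l) = (if k = l then 1 else 0)" if "l < n" for l
      using split_basisD(4)[OF e1] that k by (simp add: \<psi>'_def)
  next
    fix x assume x: "x \<in> N"
    let ?S = "\<lambda>y. (\<Sum>k<n. \<psi>1 k y *s e1 k)"
    let ?c = "u * \<psi>1 n x"
    have D: "y - (?S y + \<psi>1 n y *s e1 n) \<in> M" if "y \<in> N" for y
      using split_basisD(5)[OF e1 that] by simp
    have S: "(\<Sum>k<n. \<psi>' k x *s e1 k) = ?S x - ?c *s ?S \<beta>"
      by (simp add: \<psi>'_def scale_left_diff_distrib sum_subtractf scale_sum_right mult_ac)
    have "?c * \<psi>1 n \<beta> = \<psi>1 n x * (\<psi>1 n \<beta> * u)" by (simp only: mult_ac)
    then have "?c *s (\<psi>1 n \<beta> *s e1 n) = \<psi>1 n x *s e1 n" by (simp add: u)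
    \<comment> \<open>The letters stand for combinations of the \<open>e1 k\<close>. The identity
      regroups the left side into the residues of \<open>x\<close> and \<open>\<beta>\<close>, both
      in \<open>M\<close>, and a multiple of \<open>\<beta>\<close>.\<close>
    moreover have "x - (A - ?c *s D) = (x - (A + P)) - ?c *s (\<beta> - (D + Q)) + ?c *s \<beta>"
      if "?c *s Q = P" for A D P Q
      using that by (simp only: scale_right_diff_distrib scale_right_distrib) simp
    ultimately have "x - (\<Sum>k<n. \<psi>' k x *s e1 k) =
        (x - (?S x + \<psi>1 n x *s e1 n)) - ?c *s (\<beta> - (?S \<beta> + \<psi>1 n \<beta> *s e1 n)) + ?c *s \<beta>"
      unfolding S by blast
    also have "\<dots> \<in> span (insert \<beta> M)"
      using span_base[OF insertI2[OF D[OF x]]] span_base[OF insertI2[OF D[OF \<beta>]]]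
      by (intro span_add span_scale span_base[OF insertI1] span_diff[OF _ span_scale])
    finally show "x - (\<Sum>k<n. \<psi>' k x *s e1 k) \<in> span (insert \<beta> M)" .
  qed
  then show ?thesis by blast
qed

text \<open>The vectors \<open>b m\<close> are exchanged in one at a time. The functional
  \<open>\<phi> m\<close> is \<open>1\<close> at \<open>b m\<close> and kills the earlier ones, so
  it writes \<open>1\<close> as the sum of the \<open>\<psi> k (b m) * \<phi> m (e k)\<close>; over
  a local ring some coordinate \<open>\<psi> k (b m)\<close> is then a unit and can serve as
  pivot.\<close>

lemma split_basis_extend:
  assumes loc: "\<And>x y :: 'a. x + y dvd 1 \<Longrightarrow> x dvd 1 \<or> y dvd 1"
    and b: "split_basis scale n M {0} b \<phi>" and e: "split_basis scale h N {0} e \<psi>"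
    and M: "subspace M" "M \<subseteq> N"
  shows "n \<le> h" and "\<exists>e \<psi>. split_basis scale (h - n) N M e \<psi>"
proof -
  have "m \<le> h \<and> (\<exists>e \<psi>. split_basis scale (h - m) N (span (b ` {..<m})) e \<psi>)" if "m \<le> n" for m
    using that
  proof (induction m)
    case 0
    then show ?case using e by auto
  next
    case (Suc m)
    let ?M = "span (b ` {..<m})"
    obtain e \<psi> where e: "split_basis scale (h - m) N ?M e \<psi>" and m: "m < n" "m \<le> h"
      using Suc by auto
    interpret \<phi>: Modules.module_hom scale "(*)" "\<phi> m" using split_basisD(2)[OF b m(1)] .
    have bm: "b m \<in> N" using split_basisD(1)[OF b m(1)] M by auto
    have "\<phi> m x = 0" if "x \<in> ?M" for x
      by (rule \<phi>.eq_0_on_span[OF _ that]) (use split_basisD(4)[OF b] m in auto)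
    then have "\<phi> m (b m - (\<Sum>k<h - m. \<psi> k (b m) *s e k)) = 0"
      using split_basisD(5)[OF e bm] by blast
    then have "(\<Sum>k<h - m. \<psi> k (b m) * \<phi> m (e k)) = 1"
      using split_basisD(4)[OF b] m by (simp add: \<phi>.diff \<phi>.sum \<phi>.scale)
    then obtain k where k: "k < h - m" "\<psi> k (b m) dvd 1"
      using sum_dvd_1[OF loc, of "{..<h - m}" "\<lambda>k. \<psi> k (b m) * \<phi> m (e k)"] dvd_mult_left by auto
    then have hm: "h - m = Suc (h - Suc m)" by simp
    have "\<exists>e' \<psi>'. split_basis scale (h - Suc m) N (span (insert (b m) ?M)) e' \<psi>'"
      using e k bm unfolding hm by (intro split_basis_exchange[where j = k]) auto
    moreover have "span (insert (b m) ?M) = span (b ` {..<Suc m})"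
    proof (rule span_unique[symmetric])
      show "b ` {..<Suc m} \<subseteq> span (insert (b m) ?M)"
        by (auto simp: less_Suc_eq intro!: span_base)
      show "span (insert (b m) ?M) \<subseteq> T" if "b ` {..<Suc m} \<subseteq> T" "subspace T" for T
      proof -
        have "?M \<subseteq> T" using that by (intro span_minimal) auto
        then show ?thesis using that by (intro span_minimal) auto
      qed
    qed simp
    moreover have "Suc m \<le> h" using k(1) by simp
    ultimately show ?case by simp
  qed
  from this[of n] have "n \<le> h" and *: "\<exists>e \<psi>. split_basis scale (h - n) N (span (b ` {..<n})) e \<psi>"
    by auto
  show "n \<le> h" by fact
  have "span (b ` {..<n}) = M"
  proof (rule span_unique)
    show "b ` {..<n} \<subseteq> M" using split_basisD(1)[OF b] by auto
    show "subspace M" by fact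
    fix T assume T: "b ` {..<n} \<subseteq> T" "subspace T"
    show "M \<subseteq> T"
    proof
      fix x assume "x \<in> M"
      then have "x = (\<Sum>k<n. \<phi> k x *s b k)" using split_basisD(5)[OF b] by fastforce
      also have "\<dots> \<in> T" using T by (intro subspace_sum subspace_scale) auto
      finally show "x \<in> T" .
    qed
  qed
  then show "\<exists>e \<psi>. split_basis scale (h - n) N M e \<psi>" using * by simp
qed

text \<open>The quotient has a basis of \<open>n - n = 0\<close> vectors, so it vanishes. This
  upgrades a one-sided inclusion of twists to an equality.\<close>

lemma split_basis_eq_if_subset:
  assumes loc: "\<And>x y :: 'a. x + y dvd 1 \<Longrightarrow> x dvd 1 \<or> y dvd 1"
    and "split_basis scale n M {0} b \<phi>" "split_basis scale n N {0} e \<psi>" "subspace M" "M \<subseteq> N"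
  shows "M = N"
proof -
  obtain e \<psi> where "split_basis scale (n - n) N M e \<psi>"
    using split_basis_extend(2)[OF assms] by blast
  then show ?thesis using assms(5) by (auto simp: split_basis_def)
qed

text \<open>Coordinates with respect to a basis of \<open>M\<close> make sense only on
  \<open>M\<close>; composing them with the retraction yields functionals on the whole ambient
  module.\<close>

lemma split_basis_of_retraction:
  assumes free: "free_rank scale n M" and hom: "Modules.module_hom scale scale \<pi>"
    and \<pi>: "\<And>x. \<pi> x \<in> M" "\<And>x. x \<in> M \<Longrightarrow> \<pi> x = x"
  shows "\<exists>b \<phi>. split_basis scale n M {0} b \<phi>"
proof -
  interpret \<pi>: Modules.module_hom scale scale \<pi> by fact
  obtain S where S: "finite S" "card S = n" "independent S" "span S = M"
    using free by (auto simp: free_rank_def)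
  obtain b where b: "bij_betw b {..<n} S"
    using ex_bij_betw_nat_finite[OF S(1)] S(2) by (auto simp: atLeast0LessThan)
  define \<phi> where "\<phi> k x = representation S (\<pi> x) (b k)" for k x
  have bS: "k < n \<Longrightarrow> b k \<in> S" for k using b by (auto simp: bij_betw_def)
  have "split_basis scale n M {0} b \<phi>"
    unfolding split_basis_def
  proof (intro conjI allI impI ballI)
    fix k assume k: "k < n"
    show "b k \<in> M" using bS[OF k] S(4) span_base by auto
    show "Modules.module_hom scale (*) (\<phi> k)"
      unfolding module_hom_iff \<phi>_def
      using S \<pi> by (simp add: module_mult \<pi>.add \<pi>.scale representation_add representation_scale module_axioms)
    show "\<phi> k x = 0" if "x \<in> {0}" for x using that by (simp add: \<phi>_def representation_zero)
    show "\<phi> k (b l) = (if k = l then 1 else 0)" if "l < n" for l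
    proof -
      have "\<pi> (b l) = b l" using bS[OF that] S(4) span_base \<pi>(2) by auto
      then show ?thesis
        using b k that S(3) bS[OF that]
        by (auto simp: \<phi>_def representation_basis bij_betw_def inj_on_eq_iff)
    qed
  next
    fix x assume x: "x \<in> M"
    have "(\<Sum>k<n. \<phi> k x *s b k) = (\<Sum>v\<in>S. representation S x v *s v)"
      unfolding \<phi>_def \<pi>(2)[OF x] by (rule sum.reindex_bij_betw[OF b])
    also have "\<dots> = x" using S x by (intro sum_representation_eq) auto
    finally show "x - (\<Sum>k<n. \<phi> k x *s b k) \<in> {0}" by simp
  qed
  then show ?thesis by blast
qed

lemma subspace_free_rank: "free_rank scale n M \<Longrightarrow> subspace M"
  by (auto simp: free_rank_def)

text \<open>The projection along the complement \<open>C\<close>, preceded by \<open>\<pi>\<close>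
  because \<open>N\<close> need not be the whole ambient module. Linearity follows from uniqueness
  of the decomposition.\<close>

lemma direct_factor_retraction:
  assumes df: "direct_factor scale n M N" and hom: "Modules.module_hom scale scale \<pi>"
    and \<pi>: "\<And>x. \<pi> x \<in> N" "\<And>x. x \<in> N \<Longrightarrow> \<pi> x = x"
  shows "\<exists>q. Modules.module_hom scale scale q \<and> (\<forall>x. q x \<in> M) \<and> (\<forall>x\<in>M. q x = x)"
proof -
  interpret \<pi>: Modules.module_hom scale scale \<pi> by fact
  obtain C where C: "subspace C" "M \<inter> C = {0}" "N = {x + y | x y. x \<in> M \<and> y \<in> C}"
    and M: "free_rank scale n M" "M \<subseteq> N"
    using df by (auto simp: direct_factor_def)
  have sM: "subspace M" using subspace_free_rank M(1) .
  have "\<exists>y\<in>M. \<pi> x - y \<in> C" for x using \<pi>(1)[of x] C(3) by force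
  then obtain q where q: "q x \<in> M" "\<pi> x - q x \<in> C" for x by metis
  have uniq: "q x = y" if "y \<in> M" "\<pi> x - y \<in> C" for x y
  proof -
    have "q x - y \<in> M" using q(1) that sM subspace_diff by blast
    moreover have "(\<pi> x - y) - (\<pi> x - q x) \<in> C" using q(2) that C(1) subspace_diff by blast
    ultimately have "q x - y \<in> M \<inter> C" by simp
    then show ?thesis using C(2) by simp
  qed
  have "Modules.module_hom scale scale q"
    unfolding module_hom_iff
  proof (intro conjI allI module_axioms)
    fix x y
    show "q (x + y) = q x + q y"
    proof (rule uniq)
      have "(\<pi> x - q x) + (\<pi> y - q y) \<in> C" using q C(1) subspace_add by blast
      then show "\<pi> (x + y) - (q x + q y) \<in> C" by (simp add: \<pi>.add algebra_simps)
    qed (use q sM subspace_add in blast)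
  next
    fix c x
    show "q (c *s x) = c *s q x"
    proof (rule uniq)
      have "c *s (\<pi> x - q x) \<in> C" using q C(1) subspace_scale by blast
      then show "\<pi> (c *s x) - c *s q x \<in> C" by (simp add: \<pi>.scale algebra_simps)
    qed (use q sM subspace_scale in blast)
  qed
  moreover have "q x = x" if "x \<in> M" for x
    using that M(2) \<pi>(2) C(1) by (intro uniq) (auto simp: subspace_0)
  ultimately show ?thesis using q(1) by blast
qed

end

section \<open>Frobenius twists\<close>

locale twisted_modules = m: Modules.module s + t: Modules.module s'
  for s :: "'r::comm_ring_1 \<Rightarrow> 'e::ab_group_add \<Rightarrow> 'e" and s' :: "'r \<Rightarrow> 't::ab_group_add \<Rightarrow> 't" +
  fixes p :: nat and \<tau> :: "'e \<Rightarrow> 't"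
  assumes twist: "frobenius_twist p s s' \<tau>"
    and power_sum: "\<And>(f :: 'e \<Rightarrow> 'r) A. (\<Sum>i\<in>A. f i) ^ p = (\<Sum>i\<in>A. f i ^ p)"
begin

lemma tau_add: "\<tau> (x + y) = \<tau> x + \<tau> y" and tau_scale: "\<tau> (s c x) = s' (c ^ p) (\<tau> x)"
  using twist by (auto simp: frobenius_twist_def)

lemma tau_additive: "additive \<tau>"
  by (rule additive.intro) (rule tau_add)

lemmas tau_zero = additive.zero[OF tau_additive] and tau_diff = additive.diff[OF tau_additive]
  and tau_sum = additive.sum[OF tau_additive]

text \<open>Base change of a functional along \<open>c \<mapsto> c ^ p\<close>: it is prescribed on
  the twisted basis, and additivity of the \<open>p\<close>-th power propagates the formula to every
  \<open>\<tau> x\<close>.\<close>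

lemma twist_functional:
  assumes "Modules.module_hom s (*) \<phi>"
  shows "\<exists>\<phi>'. Modules.module_hom s' (*) \<phi>' \<and> (\<forall>x. \<phi>' (\<tau> x) = \<phi> x ^ p)"
proof -
  obtain b where b: "finite b" "m.independent b" "m.span b = UNIV"
    and tb: "inj_on \<tau> b" "t.independent (\<tau> ` b)" "t.span (\<tau> ` b) = UNIV"
    using twist unfolding frobenius_twist_def by auto
  define \<phi>' where "\<phi>' y = (\<Sum>e\<in>b. t.representation (\<tau> ` b) y (\<tau> e) * \<phi> e ^ p)" for y
  have hom': "Modules.module_hom s' (*) \<phi>'"
    unfolding module_hom_iff \<phi>'_def
    using tb by (simp add: module_mult t.module_axioms t.representation_add t.representation_scale
        sum.distrib distrib_right sum_distrib_left mult.assoc)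
  have eq: "\<phi>' (\<tau> x) = \<phi> x ^ p" for x
  proof -
    have e: "\<phi>' (\<tau> e) = \<phi> e ^ p" if "e \<in> b" for e
    proof -
      have "\<phi>' (\<tau> e) = (\<Sum>e'\<in>b. if e' = e then \<phi> e' ^ p else 0)"
        unfolding \<phi>'_def using that tb
        by (intro sum.cong refl) (auto simp: t.representation_basis inj_on_eq_iff)
      then show ?thesis using that b(1) by simp
    qed
    have x: "x = (\<Sum>e\<in>b. s (m.representation b x e) e)"
      using b by (intro m.sum_representation_eq[symmetric]) auto
    have "\<phi> x = (\<Sum>e\<in>b. m.representation b x e * \<phi> e)"
      by (subst x) (simp only: Modules.module_hom.sum[OF assms] Modules.module_hom.scale[OF assms])
    then have "\<phi> x ^ p = (\<Sum>e\<in>b. m.representation b x e ^ p * \<phi> e ^ p)"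
      by (simp add: power_sum power_mult_distrib)
    also have "\<dots> = (\<Sum>e\<in>b. m.representation b x e ^ p * \<phi>' (\<tau> e))"
      using e by simp
    also have "\<dots> = \<phi>' (\<Sum>e\<in>b. s' (m.representation b x e ^ p) (\<tau> e))"
      by (simp only: Modules.module_hom.sum[OF hom'] Modules.module_hom.scale[OF hom'])
    also have "(\<Sum>e\<in>b. s' (m.representation b x e ^ p) (\<tau> e)) = \<tau> x"
      by (subst (2) x) (simp only: tau_sum tau_scale)
    finally show ?thesis ..
  qed
  show ?thesis using hom' eq by blast
qed

text \<open>Split submodules keep their rank and their splitting under any base change, so no
  flatness of Frobenius is required, and the span of the image behaves as the true twist.\<close>

lemma twist_split_basis:
  assumes b: "split_basis s n M M' b \<phi>"
  shows "\<exists>\<phi>'. split_basis s' n (t.span (\<tau> ` M)) (t.span (\<tau> ` M')) (\<tau> \<circ> b) \<phi>'"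
proof -
  have "\<exists>\<phi>'. Modules.module_hom s' (*) \<phi>' \<and> (\<forall>x. \<phi>' (\<tau> x) = \<phi> k x ^ p)" if "k < n" for k
    using twist_functional split_basisD(2)[OF b that] .
  then obtain \<phi>' where \<phi>': "k < n \<Longrightarrow> Modules.module_hom s' (*) (\<phi>' k)"
      "k < n \<Longrightarrow> \<phi>' k (\<tau> x) = \<phi> k x ^ p" for k x by metis
  \<comment> \<open>The empty sum gives \<open>0 ^ p = 0\<close>, which excludes
    \<open>p = 0\<close>; it is needed wherever a functional vanishes.\<close>
  have p: "(0::'r) ^ p = 0" using power_sum[of "\<lambda>_. 0" "{}"] by simp
  have "split_basis s' n (t.span (\<tau> ` M)) (t.span (\<tau> ` M')) (\<tau> \<circ> b) \<phi>'"
    unfolding split_basis_def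
  proof (intro conjI allI impI ballI)
    fix k assume k: "k < n"
    show "(\<tau> \<circ> b) k \<in> t.span (\<tau> ` M)" using split_basisD(1)[OF b k] by (auto intro: t.span_base)
    show "Modules.module_hom s' (*) (\<phi>' k)" by (rule \<phi>'(1)[OF k])
    show "\<phi>' k y = 0" if "y \<in> t.span (\<tau> ` M')" for y
      by (rule Modules.module_hom.eq_0_on_span[OF \<phi>'(1)[OF k] _ that])
        (use \<phi>'(2)[OF k] split_basisD(3)[OF b k] p in auto)
    show "\<phi>' k ((\<tau> \<circ> b) l) = (if k = l then 1 else 0)" if "l < n" for l
      using \<phi>'(2)[OF k] split_basisD(4)[OF b k that] p by simp
  next
    fix y assume "y \<in> t.span (\<tau> ` M)"
    then show "y - (\<Sum>k<n. s' (\<phi>' k y) ((\<tau> \<circ> b) k)) \<in> t.span (\<tau> ` M')"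
    proof (induction rule: t.span_induct_alt)
      case base
      have "\<phi>' k 0 = 0" if "k < n" for k using Modules.module_hom.zero[OF \<phi>'(1)[OF that]] .
      then show ?case by (simp add: t.span_zero)
    next
      case (step c x y)
      then obtain z where z: "z \<in> M" "x = \<tau> z" by auto
      have "x - (\<Sum>k<n. s' (\<phi>' k x) ((\<tau> \<circ> b) k)) = \<tau> (z - (\<Sum>k<n. s (\<phi> k z) (b k)))"
        using z(2) \<phi>'(2) by (simp add: tau_diff tau_sum tau_scale)
      then have x: "x - (\<Sum>k<n. s' (\<phi>' k x) ((\<tau> \<circ> b) k)) \<in> t.span (\<tau> ` M')"
        using split_basisD(5)[OF b z(1)] by (auto intro: t.span_base)
      have hom: "\<phi>' k (s' c x + y) = c * \<phi>' k x + \<phi>' k y" if "k < n" for k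
        using Modules.module_hom.add[OF \<phi>'(1)[OF that]] Modules.module_hom.scale[OF \<phi>'(1)[OF that]] by simp
      have "(\<Sum>k<n. s' (\<phi>' k (s' c x + y)) ((\<tau> \<circ> b) k)) =
          s' c (\<Sum>k<n. s' (\<phi>' k x) ((\<tau> \<circ> b) k)) + (\<Sum>k<n. s' (\<phi>' k y) ((\<tau> \<circ> b) k))"
        using hom by (simp add: t.scale_left_distrib sum.distrib t.scale_sum_right)
      then have "s' c x + y - (\<Sum>k<n. s' (\<phi>' k (s' c x + y)) ((\<tau> \<circ> b) k)) =
          s' c (x - (\<Sum>k<n. s' (\<phi>' k x) ((\<tau> \<circ> b) k))) + (y - (\<Sum>k<n. s' (\<phi>' k y) ((\<tau> \<circ> b) k)))"
        by (simp add: t.scale_right_diff_distrib)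
      then show ?case by (simp only: t.span_add[OF t.span_scale[OF x] step.IH])
    qed
  qed
  then show ?thesis by blast
qed

text \<open>Coefficients pass through the semilinear \<open>\<tau>\<close> as \<open>p\<close>-th
  powers. Discrepancies annihilated by a determinant of small valuation disappear here.\<close>

lemma twist_kills_nilpotent:
  assumes "x - (\<Sum>k<n. s (c k) (b k)) \<in> M" "\<And>k. k < n \<Longrightarrow> c k ^ p = 0"
  shows "\<tau> x \<in> \<tau> ` M"
proof -
  have "\<tau> (x - (\<Sum>k<n. s (c k) (b k))) = \<tau> x" using assms(2) by (simp add: tau_diff tau_sum tau_scale)
  then show ?thesis using assms(1) by (metis imageI)
qed

end

section \<open>Determinants of natural maps\<close>

lemma det_product:
  fixes A C :: "nat \<times> nat \<Rightarrow> 'r::comm_ring_1"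
  shows "Determinant.det (Matrix.mat n n (\<lambda>(i, j). \<Sum>k<n. A (i, k) * C (k, j))) =
    Determinant.det (Matrix.mat n n A) * Determinant.det (Matrix.mat n n C)"
proof -
  have "Matrix.mat n n (\<lambda>(i, j). \<Sum>k<n. A (i, k) * C (k, j)) = Matrix.mat n n A * Matrix.mat n n C"
    by (intro eq_matI) (auto simp: scalar_prod_def atLeast0LessThan)
  then show ?thesis by (simp add: det_mult[of _ n])
qed

text \<open>Cramer's rule on both sides. The left identity turns \<open>m c = 0\<close> into
  \<open>det m * c = 0\<close> and bounds kernels; the right one writes \<open>det m\<close> times a
  target vector through the images and bounds cokernels.\<close>

lemma adjugate_coeffs:
  fixes m :: "nat \<times> nat \<Rightarrow> 'r::comm_ring_1"
  obtains a where "\<And>i j. i < n \<Longrightarrow> j < n \<Longrightarrow>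
      (\<Sum>k<n. a i k * m (k, j)) = (if i = j then Determinant.det (Matrix.mat n n m) else 0)"
    "\<And>i j. i < n \<Longrightarrow> j < n \<Longrightarrow>
      (\<Sum>k<n. m (i, k) * a k j) = (if i = j then Determinant.det (Matrix.mat n n m) else 0)"
proof -
  let ?M = "Matrix.mat n n m"
  let ?A = "adj_mat ?M"
  have M: "?M \<in> carrier_mat n n" by simp
  note adj = adj_mat[OF M]
  show ?thesis
  proof (rule that[of "\<lambda>i k. ?A $$ (i, k)"])
    fix i j assume ij: "i < n" "j < n"
    have "(?A * ?M) $$ (i, j) = (\<Sum>k<n. ?A $$ (i, k) * m (k, j))"
      using ij adj(1) by (simp add: scalar_prod_def atLeast0LessThan)
    then show "(\<Sum>k<n. ?A $$ (i, k) * m (k, j)) = (if i = j then Determinant.det ?M else 0)"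
      using ij unfolding adj(3) by (auto split: if_splits)
    have "(?M * ?A) $$ (i, j) = (\<Sum>k<n. m (i, k) * ?A $$ (k, j))"
      using ij adj(1) by (simp add: scalar_prod_def atLeast0LessThan)
    then show "(\<Sum>k<n. m (i, k) * ?A $$ (k, j)) = (if i = j then Determinant.det ?M else 0)"
      using ij unfolding adj(2) by (auto split: if_splits)
  qed
qed

context Modules.module
begin

lemma natural_map_det_exists:
  assumes b: "quotient_basis scale n M M' b" and b': "quotient_basis scale n N N' b'" and "M \<subseteq> N"
  shows "\<exists>t. natural_map_det scale n M M' N N' t"
proof -
  have "\<exists>c. b k - (\<Sum>l<n. c l *s b' l) \<in> N'" if "k < n" for k
    using quotient_basisD[OF b] quotient_basisD[OF b'] assms(3) that by blast
  then obtain c where "k < n \<Longrightarrow> b k - (\<Sum>l<n. c k l *s b' l) \<in> N'" for k by metis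
  then show ?thesis using b b' unfolding natural_map_det_def
    by (intro exI[of _ "Determinant.det (Matrix.mat n n (\<lambda>(l, k). c k l))"] exI[of _ b] exI[of _ b']
        exI[of _ "\<lambda>(l, k). c k l"]) simp
qed

text \<open>Both determinants describe the same cokernel \<open>N / (M + N')\<close>. Writing
  \<open>b1\<close> through \<open>b\<close> and \<open>b'\<close> through \<open>b1'\<close>
  factors the second matrix as \<open>q m u\<close>; the first rewriting is only modulo
  \<open>M'\<close>, which is harmless as \<open>M' \<subseteq> N'\<close>.\<close>

lemma natural_map_det_dvd:
  assumes t: "natural_map_det scale n M M' N N' t" and t1: "natural_map_det scale n M M1' N N' t1"
    and sub: "subspace N'" "M' \<subseteq> N'" "subspace N"
  shows "t dvd t1"
proof -
  obtain b b' m where b: "quotient_basis scale n M M' b" and b': "quotient_basis scale n N N' b'"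
    and m: "\<And>k. k < n \<Longrightarrow> b k - (\<Sum>l<n. m (l, k) *s b' l) \<in> N'" and t: "t = Determinant.det (Matrix.mat n n m)"
    using t unfolding natural_map_det_def by blast
  obtain b1 b1' m1 where b1: "quotient_basis scale n M M1' b1" and b1': "quotient_basis scale n N N' b1'"
    and m1: "\<And>k. k < n \<Longrightarrow> b1 k - (\<Sum>l<n. m1 (l, k) *s b1' l) \<in> N'"
    and t1: "t1 = Determinant.det (Matrix.mat n n m1)"
    using t1 unfolding natural_map_det_def by blast
  have "\<exists>u. b1 k - (\<Sum>l<n. u l *s b l) \<in> M'" if "k < n" for k
    using quotient_basisD[OF b1] quotient_basisD[OF b] that by blast
  then obtain u' where u': "k < n \<Longrightarrow> b1 k - (\<Sum>l<n. u' k l *s b l) \<in> M'" for k by metis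
  define u where "u = (\<lambda>(l, k). u' k l)"
  have u: "k < n \<Longrightarrow> b1 k - (\<Sum>l<n. u (l, k) *s b l) \<in> M'" for k using u' by (simp add: u_def)
  have "\<exists>q. b' k - (\<Sum>l<n. q l *s b1' l) \<in> N'" if "k < n" for k
    using quotient_basisD[OF b'] quotient_basisD[OF b1'] that by blast
  then obtain q' where q': "k < n \<Longrightarrow> b' k - (\<Sum>l<n. q' k l *s b1' l) \<in> N'" for k by metis
  define q where "q = (\<lambda>(l, k). q' k l)"
  have q: "k < n \<Longrightarrow> b' k - (\<Sum>l<n. q (l, k) *s b1' l) \<in> N'" for k using q' by (simp add: q_def)
  have comb: "(\<Sum>k<n. c k *s x k) - (\<Sum>l<n. (\<Sum>k<n. w (l, k) * c k) *s y l) \<in> N'"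
    if "\<And>k. k < n \<Longrightarrow> x k - (\<Sum>l<n. w (l, k) *s y l) \<in> N'" for c x w and y :: "nat \<Rightarrow> 'b"
  proof -
    have "(\<Sum>k<n. c k *s (\<Sum>l<n. w (l, k) *s y l)) = (\<Sum>l<n. (\<Sum>k<n. w (l, k) * c k) *s y l)"
      unfolding scale_sum_right scale_sum_left scale_scale
      by (subst sum.swap) (simp add: mult.commute)
    then have "(\<Sum>k<n. c k *s x k) - (\<Sum>l<n. (\<Sum>k<n. w (l, k) * c k) *s y l) =
        (\<Sum>k<n. c k *s (x k - (\<Sum>l<n. w (l, k) *s y l)))"
      by (simp only: scale_right_diff_distrib sum_subtractf)
    also have "\<dots> \<in> N'" using that sub by (intro subspace_sum subspace_scale) auto
    finally show ?thesis .
  qed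
  \<comment> \<open>Coordinates of \<open>b1\<close> are pushed along \<open>b\<close>,
    \<open>b'\<close>, \<open>b1'\<close> in turn, with matrices \<open>u\<close>, \<open>m\<close>,
    \<open>q\<close>; everything holds modulo \<open>N'\<close>.\<close>
  define w where "w = (\<lambda>(i, k). \<Sum>j<n. m (i, j) * u (j, k))"
  define z where "z = (\<lambda>(i, k). \<Sum>j<n. q (i, j) * w (j, k))"
  have "m1 (i, k) = z (i, k)" if "i < n" "k < n" for i k
  proof -
    let ?x = "\<Sum>l<n. u (l, k) *s b l" and ?y = "\<Sum>l<n. w (l, k) *s b' l"
    have 1: "b1 k - ?x \<in> N'" using u that sub(2) by blast
    have 2: "?x - ?y \<in> N'" unfolding w_def prod.case by (rule comb) (rule m)
    have 3: "?y - (\<Sum>l<n. z (l, k) *s b1' l) \<in> N'" unfolding z_def prod.case by (rule comb) (rule q)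
    have "(b1 k - ?x) + (?x - ?y) + (?y - (\<Sum>l<n. z (l, k) *s b1' l)) - (b1 k - (\<Sum>l<n. m1 (l, k) *s b1' l)) \<in> N'"
      using 1 2 3 m1[OF that(2)] sub(1) by (blast intro: subspace_diff subspace_add)
    then have "(\<Sum>l<n. (m1 (l, k) - z (l, k)) *s b1' l) \<in> N'"
      by (simp add: scale_left_diff_distrib sum_subtractf)
    then have "m1 (i, k) - z (i, k) = 0"
      using quotient_basis_indep[OF b1' _ _ _ that(1), of "\<lambda>l. m1 (l, k) - z (l, k)"] sub subspace_0 by blast
    then show ?thesis by simp
  qed
  then have "Matrix.mat n n m1 = Matrix.mat n n z" by (intro eq_matI) auto
  then have "t1 = Determinant.det (Matrix.mat n n q) * (t * Determinant.det (Matrix.mat n n u))"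
    unfolding t1 t z_def w_def by (simp only: det_product)
  then show ?thesis by simp
qed

text \<open>Vectors of \<open>M\<close> need not lie in \<open>M1\<close>, but the functionals
  \<open>\<mu>\<close> are defined everywhere. Evaluating them on \<open>b'\<close> gives a matrix
  \<open>q\<close> through which the coordinates of \<open>b\<close> in \<open>M1 / F\<close>
  factor.\<close>

lemma natural_map_det_change_target:
  assumes t: "natural_map_det scale n S S' M F t" and e: "split_basis scale n M1 F e \<mu>"
    and sub: "S \<subseteq> M1" "subspace F"
  shows "\<exists>t1. natural_map_det scale n S S' M1 F t1 \<and> t dvd t1"
proof -
  obtain b b' m where b: "quotient_basis scale n S S' b" and b': "quotient_basis scale n M F b'"
    and m: "\<And>k. k < n \<Longrightarrow> b k - (\<Sum>l<n. m (l, k) *s b' l) \<in> F" and t: "t = Determinant.det (Matrix.mat n n m)"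
    using t unfolding natural_map_det_def by blast
  define q where "q = (\<lambda>(i, j). \<mu> i (b' j))"
  define z where "z = (\<lambda>(i, k). \<Sum>j<n. q (i, j) * m (j, k))"
  have z: "z (i, k) = \<mu> i (b k)" if "i < n" "k < n" for i k
  proof -
    note hom = split_basisD(2)[OF e that(1)]
    have "\<mu> i (b k) = \<mu> i (\<Sum>l<n. m (l, k) *s b' l)"
      using split_basisD(3)[OF e that(1) m[OF that(2)]] Modules.module_hom.diff[OF hom] by simp
    also have "\<dots> = z (i, k)"
      by (simp add: Modules.module_hom.sum[OF hom] Modules.module_hom.scale[OF hom] z_def q_def mult.commute)
    finally show ?thesis by simp
  qed
  have "natural_map_det scale n S S' M1 F (Determinant.det (Matrix.mat n n z))"
  proof -
    have "b k - (\<Sum>l<n. z (l, k) *s e l) \<in> F" if k: "k < n" for k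
    proof -
      have "b k \<in> M1" using quotient_basisD(1)[OF b k] sub by blast
      from split_basisD(5)[OF e this] show ?thesis using z k by simp
    qed
    then show ?thesis
      using b split_basis_imp_quotient_basis[OF e sub(2)] unfolding natural_map_det_def by blast
  qed
  moreover have "Determinant.det (Matrix.mat n n z) = Determinant.det (Matrix.mat n n q) * t"
    unfolding t z_def by (rule det_product)
  ultimately show ?thesis by auto
qed

text \<open>The coordinates of \<open>x\<close> modulo \<open>M\<close> form a vector in the kernel
  of the matrix; multiplying by the adjugate shows that the determinant kills each of them.\<close>

lemma natural_map_det_annihilates_kernel:
  assumes t: "natural_map_det scale n F M E N t"
    and sub: "subspace F" "subspace M" "subspace E" "subspace N" "M \<subseteq> N"
    and x: "x \<in> F" "x \<in> N"
  shows "\<exists>c b. (\<forall>k<n. c k * t = 0) \<and> x - (\<Sum>k<n. c k *s b k) \<in> M"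
proof -
  obtain b b' m where b: "quotient_basis scale n F M b" and b': "quotient_basis scale n E N b'"
    and m: "\<And>k. k < n \<Longrightarrow> b k - (\<Sum>l<n. m (l, k) *s b' l) \<in> N" and t: "t = Determinant.det (Matrix.mat n n m)"
    using t unfolding natural_map_det_def by blast
  obtain c where c: "x - (\<Sum>k<n. c k *s b k) \<in> M" using quotient_basisD(2)[OF b x(1)] by blast
  let ?y = "\<Sum>l<n. (\<Sum>k<n. m (l, k) * c k) *s b' l"
  have "(\<Sum>k<n. c k *s (\<Sum>l<n. m (l, k) *s b' l)) = ?y"
    unfolding scale_sum_right scale_sum_left scale_scale
    by (subst sum.swap) (simp add: mult.commute)
  then have y: "?y = x - (x - (\<Sum>k<n. c k *s b k)) - (\<Sum>k<n. c k *s (b k - (\<Sum>l<n. m (l, k) *s b' l)))"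
    by (simp add: scale_right_diff_distrib sum_subtractf)
  have "(\<Sum>k<n. c k *s (b k - (\<Sum>l<n. m (l, k) *s b' l))) \<in> N"
    using m sub by (intro subspace_sum subspace_scale) auto
  moreover have "x - (\<Sum>k<n. c k *s b k) \<in> N" using c sub by blast
  ultimately have "?y \<in> N"
    unfolding y using x sub(4) by (blast intro: subspace_diff)
  then have 0: "(\<Sum>k<n. m (l, k) * c k) = 0" if "l < n" for l
    using quotient_basis_indep[OF b' _ _ _ that, of "\<lambda>l. \<Sum>k<n. m (l, k) * c k"] sub subspace_0 by blast
  obtain a where a: "\<And>i j. i < n \<Longrightarrow> j < n \<Longrightarrow> (\<Sum>k<n. a i k * m (k, j)) = (if i = j then t else 0)"
    using adjugate_coeffs(1)[of n m thesis] unfolding t by blast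
  have "c k * t = 0" if k: "k < n" for k
  proof -
    have "c k * t = (\<Sum>j<n. (if k = j then t else 0) * c j)"
      using k by (simp add: if_distrib[of "\<lambda>x. x * _"] mult.commute[of t] cong: if_cong)
    also have "\<dots> = (\<Sum>j<n. (\<Sum>l<n. a k l * m (l, j)) * c j)"
      using a k by simp
    also have "\<dots> = (\<Sum>l<n. a k l * (\<Sum>j<n. m (l, j) * c j))"
      unfolding sum_distrib_left sum_distrib_right mult.assoc by (rule sum.swap)
    also have "\<dots> = 0" using 0 by simp
    finally show ?thesis .
  qed
  then show ?thesis using c by blast
qed

text \<open>By the adjugate, \<open>t\<close> times a target basis vector is a combination of images
  of source vectors modulo \<open>F\<close>, and \<open>M'\<close> contains both \<open>N\<close>
  and \<open>F\<close>.\<close>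

lemma natural_map_det_annihilates_cokernel:
  assumes t: "natural_map_det scale n N S M F t"
    and sub: "subspace M'" "N \<subseteq> M'" "F \<subseteq> M'" and x: "x \<in> M"
  shows "t *s x \<in> M'"
proof -
  obtain b b' m where b: "quotient_basis scale n N S b" and b': "quotient_basis scale n M F b'"
    and m: "\<And>k. k < n \<Longrightarrow> b k - (\<Sum>l<n. m (l, k) *s b' l) \<in> F" and t: "t = Determinant.det (Matrix.mat n n m)"
    using t unfolding natural_map_det_def by blast
  obtain c where c: "x - (\<Sum>k<n. c k *s b' k) \<in> F" using quotient_basisD(2)[OF b' x] by blast
  obtain a where a: "\<And>i j. i < n \<Longrightarrow> j < n \<Longrightarrow> (\<Sum>k<n. m (i, k) * a k j) = (if i = j then t else 0)"
    using adjugate_coeffs(1)[of n m thesis] unfolding t by blast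
  have im: "(\<Sum>l<n. m (l, k) *s b' l) \<in> M'" if "k < n" for k
  proof -
    have "b k - (b k - (\<Sum>l<n. m (l, k) *s b' l)) \<in> M'"
      by (rule subspace_diff[OF sub(1)]) (use sub m[OF that] quotient_basisD(1)[OF b that] in blast)+
    then show ?thesis by simp
  qed
  have tb: "t *s b' j \<in> M'" if j: "j < n" for j
  proof -
    have "t *s b' j = (\<Sum>l<n. (if l = j then t else 0) *s b' l)"
      using j by (simp add: if_distrib[of "\<lambda>x. x *s _"] cong: if_cong)
    also have "\<dots> = (\<Sum>l<n. (\<Sum>k<n. m (l, k) * a k j) *s b' l)" using a j by simp
    also have "\<dots> = (\<Sum>k<n. a k j *s (\<Sum>l<n. m (l, k) *s b' l))"
      unfolding scale_sum_right scale_sum_left scale_scale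
      by (subst sum.swap) (simp add: mult.commute)
    also have "\<dots> \<in> M'"
      by (rule subspace_sum[OF sub(1)], rule subspace_scale[OF sub(1)]) (use im in simp)
    finally show ?thesis .
  qed
  have "t *s x = t *s (x - (\<Sum>k<n. c k *s b' k)) + (\<Sum>k<n. c k *s (t *s b' k))"
    by (simp add: scale_right_diff_distrib scale_sum_right mult.commute)
  also have "\<dots> \<in> M'"
  proof (rule subspace_add[OF sub(1)])
    show "t *s (x - (\<Sum>k<n. c k *s b' k)) \<in> M'" using c sub by (blast intro: subspace_scale)
    show "(\<Sum>k<n. c k *s (t *s b' k)) \<in> M'"
      by (rule subspace_sum[OF sub(1)], rule subspace_scale[OF sub(1)]) (use tb in simp)
  qed
  finally show ?thesis .
qed

end

section \<open>One step of an adequate filtration\<close>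

text \<open>For fixed \<open>j\<close>, the members \<open>\<F>\<^sub>i\<^sup>[\<^sup>j\<^sup>]\<close> of an adequate filtration depend on \<open>j\<close> only through
  \<open>\<delta> = \<delta>\<^sub>j\<close>, and \<open>j \<le> s(i)\<close> means \<open>\<delta> \<le> d\<^sub>i\<close>.\<close>

definition slice_tilde ::
  "('k, 'l::field_char_0, 'r::comm_ring_1) base_data \<Rightarrow> (nat \<Rightarrow> nat) \<Rightarrow>
   ('l, 'r, 'e::ab_group_add, 't::ab_group_add) dieudonne \<Rightarrow> nat \<Rightarrow> (nat \<Rightarrow> 'e set) \<Rightarrow> nat \<Rightarrow> 'e set"
where
  "slice_tilde B d X \<delta> M i =
     (if \<delta> \<le> d (prev_index B i)
      then {x \<in> isotypic B X i. Ver X x \<in> tw X (M (prev_index B i))}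
      else Frob X ` tw X (M (prev_index B i)))"

text \<open>The case \<open>\<delta> = d i\<close> falls into the first branch, where rank
  \<open>0\<close> encodes the convention that this member of the filtration vanishes. Direct
  factors appear as split bases, ready to be twisted.\<close>

definition slice ::
  "('k, 'l::field_char_0, 'r::comm_ring_1) base_data \<Rightarrow> nat \<Rightarrow> (nat \<Rightarrow> nat) \<Rightarrow>
   ('l, 'r, 'e::ab_group_add, 't::ab_group_add) dieudonne \<Rightarrow> nat \<Rightarrow> (nat \<Rightarrow> 'e set) \<Rightarrow> bool"
where
  "slice B h d X \<delta> M \<longleftrightarrow>
     (\<forall>i<dgr B. Modules.module.subspace (scl X) (M i) \<and> M i \<subseteq> isotypic B X i \<and>
        (if \<delta> \<le> d i
         then (\<exists>b \<phi>. split_basis (scl X) (d i - \<delta>) (M i) {0} b \<phi>) \<and>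
           M i \<subseteq> hodge_isotypic B X i \<and> M i \<subseteq> slice_tilde B d X \<delta> M i
         else (\<exists>b \<phi>. split_basis (scl X) (h + d i - \<delta>) (M i) {0} b \<phi>) \<and>
           hodge_isotypic B X i \<subseteq> M i \<and> slice_tilde B d X \<delta> M i \<subseteq> M i))"

definition slice_det ::
  "('k, 'l::field_char_0, 'r::comm_ring_1) base_data \<Rightarrow> nat \<Rightarrow> (nat \<Rightarrow> nat) \<Rightarrow>
   ('l, 'r, 'e::ab_group_add, 't::ab_group_add) dieudonne \<Rightarrow> nat \<Rightarrow> (nat \<Rightarrow> 'e set) \<Rightarrow> nat \<Rightarrow> 'r \<Rightarrow> bool"
where
  "slice_det B h d X \<delta> M i t \<longleftrightarrow>
     (if \<delta> \<le> d i
      then natural_map_det (scl X) \<delta>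
             (hodge_isotypic B X i) (M i) (isotypic B X i) (slice_tilde B d X \<delta> M i) t
      else natural_map_det (scl X) (h - \<delta>)
             (slice_tilde B d X \<delta> M i) {0} (M i) (hodge_isotypic B X i) t)"

lemma prev_index_less: "i < dgr B \<Longrightarrow> prev_index B i < dgr B"
  by (simp add: prev_index_def)

lemma cyclic_induct:
  assumes i0: "i0 < dgr B" "P i0" and step: "\<And>i. i < dgr B \<Longrightarrow> P (prev_index B i) \<Longrightarrow> P i"
    and i: "i < dgr B"
  shows "P i"
proof -
  have "P ((i0 + k) mod dgr B)" for k
  proof (induction k)
    case (Suc k)
    let ?i = "(i0 + Suc k) mod dgr B"
    have "?i < dgr B" using i by simp
    moreover have "prev_index B ?i = (i0 + k) mod dgr B"
    proof -
      have "prev_index B ?i = (?i + (dgr B - 1)) mod dgr B"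
        using i by (simp add: prev_index_def)
      also have "\<dots> = (i0 + Suc k + (dgr B - 1)) mod dgr B" by (rule mod_add_left_eq)
      also have "i0 + Suc k + (dgr B - 1) = i0 + k + dgr B" using i by simp
      finally show ?thesis by simp
    qed
    ultimately show ?case using step Suc by metis
  qed (use i0 in simp)
  \<comment> \<open>Adding \<open>dgr B\<close> first keeps the subtraction of naturals from being
    truncated.\<close>
  from this[of "i + dgr B - i0"] show ?thesis using i i0 by simp
qed

context
  fixes B :: "('k::field_char_0, 'l::field_char_0, 'r::comm_ring_1) base_data"
    and X :: "('l, 'r, 'e::ab_group_add, 't::ab_group_add) dieudonne"
    and h :: nat and d :: "nat \<Rightarrow> nat"
  assumes B: "admissible_base B" and X: "dieudonne_module B h d X"
begin

interpretation E: Modules.module "scl X" using X by (simp add: dieudonne_module_def)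
interpretation T: Modules.module "scl_tw X" using X by (simp add: dieudonne_module_def)
interpretation F: Modules.module_hom "scl_tw X" "scl X" "Frob X" using X by (simp add: dieudonne_module_def)
interpretation V: Modules.module_hom "scl X" "scl_tw X" "Ver X" using X by (simp add: dieudonne_module_def)
interpretation W: twisted_modules "scl X" "scl_tw X" "prm B" "twi X"
  by unfold_locales (use X power_prm_sum[OF B] in \<open>auto simp: dieudonne_module_def\<close>)

section \<open>Isotypic components, Hodge filtration and their twists as split submodules\<close>

lemma isotypic_subspace: "E.subspace (isotypic B X i)"
proof -
  have hom: "Modules.module_hom (scl X) (scl X) (act X a)" if "a \<in> val_ring (valF B)" for a
    using X that by (simp add: dieudonne_module_def)
  show ?thesis
    unfolding isotypic_def
    using Modules.module_hom.zero[OF hom] Modules.module_hom.add[OF hom] Modules.module_hom.scale[OF hom]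
    by (intro E.subspaceI) (auto simp: E.scale_right_distrib mult.commute)
qed

text \<open>The \<open>i\<close>-th component of the unique decomposition is linear by uniqueness.
  It extends functionals from one isotypic component to the whole module, as split bases
  demand.\<close>

lemma isotypic_projection:
  assumes i: "i < dgr B"
  shows "\<exists>\<pi>. Modules.module_hom (scl X) (scl X) \<pi> \<and> (\<forall>x. \<pi> x \<in> isotypic B X i) \<and>
    (\<forall>x\<in>isotypic B X i. \<pi> x = x)"
proof -
  let ?P = "\<lambda>x c. (\<forall>i<dgr B. c i \<in> isotypic B X i) \<and> (\<forall>i\<ge>dgr B. c i = 0) \<and> x = (\<Sum>i<dgr B. c i)"
  have ex1: "\<exists>!c. ?P x c" for x using X by (simp add: dieudonne_module_def)
  define c where "c x = (THE c. ?P x c)" for x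
  have c: "?P x (c x)" for x unfolding c_def by (rule theI'[OF ex1])
  have uniq: "c x = c'" if "?P x c'" for x c' using ex1_unique[of "?P x", OF ex1[of x] c[of x] that] .
  have add: "c (x + y) = (\<lambda>i. c x i + c y i)" for x y
    using c[of x] c[of y] by (intro uniq) (auto simp: sum.distrib E.subspace_add[OF isotypic_subspace])
  have scl: "c (scl X a x) = (\<lambda>i. scl X a (c x i))" for a x
    using c[of x] by (intro uniq) (auto simp: E.subspace_scale[OF isotypic_subspace] E.scale_sum_right[symmetric])
  have "c x = (\<lambda>k. if k = i then x else 0)" if "x \<in> isotypic B X i" for x
    using that i E.subspace_0[OF isotypic_subspace] by (intro uniq) auto
  then show ?thesis
    using add scl c i by (intro exI[of _ "\<lambda>x. c x i"] conjI) (auto simp: module_hom_iff E.module_axioms)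
qed

lemma direct_factor_split:
  assumes i: "i < dgr B" and df: "direct_factor (scl X) n M (isotypic B X i)"
  shows "E.subspace M" "M \<subseteq> isotypic B X i" "\<exists>b \<phi>. split_basis (scl X) n M {0} b \<phi>"
proof -
  have free: "free_rank (scl X) n M" and sub: "M \<subseteq> isotypic B X i" using df by (auto simp: direct_factor_def)
  obtain \<pi> where "Modules.module_hom (scl X) (scl X) \<pi>" "\<And>x. \<pi> x \<in> isotypic B X i"
      "\<And>x. x \<in> isotypic B X i \<Longrightarrow> \<pi> x = x"
    using isotypic_projection[OF i] by blast
  from E.direct_factor_retraction[OF df this] obtain q
    where "Modules.module_hom (scl X) (scl X) q" "\<And>x. q x \<in> M" "\<And>x. x \<in> M \<Longrightarrow> q x = x" by blast
  from E.split_basis_of_retraction[OF free this]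
  show "\<exists>b \<phi>. split_basis (scl X) n M {0} b \<phi>" .
  show "E.subspace M" using E.subspace_free_rank[OF free] .
  show "M \<subseteq> isotypic B X i" by fact
qed

lemma isotypic_split:
  assumes "i < dgr B"
  shows "\<exists>b \<phi>. split_basis (scl X) h (isotypic B X i) {0} b \<phi>"
proof -
  have "free_rank (scl X) h (isotypic B X i)" using X assms by (simp add: dieudonne_module_def)
  then show ?thesis using isotypic_projection[OF assms] E.split_basis_of_retraction by blast
qed

lemma hodge_split:
  assumes "i < dgr B"
  shows "E.subspace (hodge_isotypic B X i)" "hodge_isotypic B X i \<subseteq> isotypic B X i"
    "\<exists>b \<phi>. split_basis (scl X) (d i) (hodge_isotypic B X i) {0} b \<phi>"
proof -
  have "direct_factor (scl X) (d i) (hodge_isotypic B X i) (isotypic B X i)"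
    using X assms by (simp add: dieudonne_module_def)
  from direct_factor_split[OF assms this] show
    "E.subspace (hodge_isotypic B X i)" "hodge_isotypic B X i \<subseteq> isotypic B X i"
    "\<exists>b \<phi>. split_basis (scl X) (d i) (hodge_isotypic B X i) {0} b \<phi>" .
qed

lemma hodge_rank_le: "i < dgr B \<Longrightarrow> d i \<le> h"
  using hodge_split[of i] isotypic_split[of i] E.split_basis_extend(1)[OF base_local[OF B]] by blast

lemma tw_subspace: "T.subspace (tw X M)" and tw_mono: "M \<subseteq> N \<Longrightarrow> tw X M \<subseteq> tw X N"
  and tw_zero: "tw X {0} = {0}"
  unfolding tw_def by (auto intro!: T.span_mono simp: W.tau_zero T.span_singleton)

lemma tw_split:
  assumes "\<exists>b \<phi>. split_basis (scl X) n M M' b \<phi>"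
  shows "\<exists>b \<phi>. split_basis (scl_tw X) n (tw X M) (tw X M') b \<phi>"
  using assms W.twist_split_basis unfolding tw_def by blast

lemma tw_quotient_basis:
  assumes "\<exists>b \<phi>. split_basis (scl X) n M M' b \<phi>"
  shows "\<exists>b. quotient_basis (scl_tw X) n (tw X M) (tw X M') b"
  using tw_split[OF assms] T.split_basis_imp_quotient_basis[OF _ tw_subspace] by blast

lemma split_quotient:
  assumes "\<exists>b \<phi>. split_basis (scl X) n M {0} b \<phi>" "\<exists>b \<phi>. split_basis (scl X) m N {0} b \<phi>"
    "E.subspace M" "M \<subseteq> N"
  shows "\<exists>b \<phi>. split_basis (scl X) (m - n) N M b \<phi>"
  using assms E.split_basis_extend(2)[OF base_local[OF B]] by blast

lemma tw_eq_if_subset: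
  assumes "\<exists>b \<phi>. split_basis (scl X) n M {0} b \<phi>" "\<exists>b \<phi>. split_basis (scl X) n N {0} b \<phi>"
    "tw X M \<subseteq> tw X N"
  shows "tw X M = tw X N"
proof -
  obtain b \<phi> where b: "split_basis (scl_tw X) n (tw X M) {0} b \<phi>"
    using tw_split[OF assms(1)] unfolding tw_zero by blast
  obtain e \<psi> where e: "split_basis (scl_tw X) n (tw X N) {0} e \<psi>"
    using tw_split[OF assms(2)] unfolding tw_zero by blast
  show ?thesis
    by (rule T.split_basis_eq_if_subset[OF base_local[OF B] b e tw_subspace assms(3)])
qed

lemma slice_tilde_zero: "0 \<in> slice_tilde B d X \<delta> M i"
proof -
  have "Frob X 0 \<in> Frob X ` tw X (M (prev_index B i))"
    by (rule imageI[OF T.subspace_0[OF tw_subspace]])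
  then show ?thesis
    using E.subspace_0[OF isotypic_subspace] T.subspace_0[OF tw_subspace]
    by (simp add: slice_tilde_def F.zero V.zero)
qed

section \<open>Frobenius and Verschiebung between consecutive indices\<close>

context
  fixes i i' :: nat
  assumes i: "i < dgr B" and i': "i' = prev_index B i"
begin

lemma i'_less: "i' < dgr B" using prev_index_less[OF i] i' by simp

lemma Ver_image: "Ver X ` isotypic B X i = tw X (hodge_isotypic B X i')"
  using X i i' by (simp add: dieudonne_module_def)

lemma Ver_kernel: "{x \<in> isotypic B X i. Ver X x = 0} = Frob X ` tw X (isotypic B X i')"
  using X i unfolding i' by (simp add: dieudonne_module_def)

lemma Frob_kernel: "{y \<in> tw X (isotypic B X i'). Frob X y = 0} = tw X (hodge_isotypic B X i')"
proof -
  have "{y \<in> tw X (isotypic B X i'). Frob X y = 0} = Ver X ` isotypic B X i"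
    using X i unfolding i' by (simp add: dieudonne_module_def)
  then show ?thesis by (simp only: Ver_image)
qed

lemma Frob_hodge: "Frob X ` tw X (hodge_isotypic B X i') = {0}"
proof -
  have "Frob X 0 \<in> Frob X ` tw X (hodge_isotypic B X i')"
    by (rule imageI[OF T.subspace_0[OF tw_subspace]])
  moreover have "Frob X y = 0" if "y \<in> tw X (hodge_isotypic B X i')" for y
    using that unfolding Frob_kernel[symmetric] by blast
  ultimately show ?thesis using F.zero by auto
qed

lemma Frob_image_subspace: "E.subspace (Frob X ` tw X M)"
  by (rule F.subspace_image[OF tw_subspace])

lemma Frob_image_subset: "M \<subseteq> isotypic B X i' \<Longrightarrow> Frob X ` tw X M \<subseteq> isotypic B X i"
  using tw_mono[of M] Ver_kernel by blast

lemma Ver_preimage_subspace: "E.subspace {x \<in> isotypic B X i. Ver X x \<in> tw X M}"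
  using E.subspace_inter[OF isotypic_subspace V.subspace_linear_preimage[OF tw_subspace]]
  by (simp add: Int_def)

lemma quotient_Frob_image:
  assumes "\<exists>b \<phi>. split_basis (scl X) n M N b \<phi>" "hodge_isotypic B X i' \<subseteq> N" "N \<subseteq> M" "M \<subseteq> isotypic B X i'"
  shows "\<exists>b. quotient_basis (scl X) n (Frob X ` tw X M) (Frob X ` tw X N) b"
proof -
  obtain b where b: "quotient_basis (scl_tw X) n (tw X M) (tw X N) b" using tw_quotient_basis[OF assms(1)] by blast
  have "{y \<in> tw X M. Frob X y = 0} \<subseteq> tw X N"
    using Frob_kernel tw_mono[OF assms(4)] tw_mono[OF assms(2)] by blast
  from F.quotient_basis_image[OF b tw_subspace tw_subspace tw_mono[OF assms(3)] this] show ?thesis by blast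
qed

lemma quotient_Ver_preimage:
  assumes "\<exists>b \<phi>. split_basis (scl X) n M N b \<phi>" "M \<subseteq> hodge_isotypic B X i'" "N \<subseteq> M"
  shows "\<exists>b. quotient_basis (scl X) n {x \<in> isotypic B X i. Ver X x \<in> tw X M} {x \<in> isotypic B X i. Ver X x \<in> tw X N} b"
proof -
  obtain b where b: "quotient_basis (scl_tw X) n (tw X M) (tw X N) b" using tw_quotient_basis[OF assms(1)] by blast
  have im: "Ver X ` {x \<in> isotypic B X i. Ver X x \<in> tw X M} = tw X M"
    using tw_mono[OF assms(2)] unfolding Ver_image[symmetric] by blast
  have "{x \<in> {x \<in> isotypic B X i. Ver X x \<in> tw X M}. Ver X x \<in> tw X N} = {x \<in> isotypic B X i. Ver X x \<in> tw X N}"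
    using tw_mono[OF assms(3)] by blast
  with V.quotient_basis_pullback[OF b Ver_preimage_subspace tw_subspace im tw_mono[OF assms(3)]]
  show ?thesis by simp
qed

lemma Ver_preimage_hodge: "{x \<in> isotypic B X i. Ver X x \<in> tw X (hodge_isotypic B X i')} = isotypic B X i"
  unfolding Ver_image[symmetric] by blast

lemma Ver_preimage_zero: "{x \<in> isotypic B X i. Ver X x \<in> tw X {0}} = Frob X ` tw X (isotypic B X i')"
  using Ver_kernel by (simp add: tw_zero)

text \<open>In both cases the new module \<open>N\<close> has rank \<open>h - \<delta>\<close>, so
  the determinants are those of square matrices. If \<open>\<delta> \<le> d i'\<close>, Verschiebung
  gives rank \<open>\<delta>\<close> for the quotient by \<open>N\<close>, and \<open>N\<close> is
  an extension of ranks \<open>d i' - \<delta>\<close> and \<open>h - d i'\<close> around the image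
  of Frobenius. Otherwise that image has corank \<open>d i'\<close> and contains \<open>N\<close>
  with corank \<open>\<delta> - d i'\<close>, while \<open>N\<close> is the twist of
  \<open>M i'\<close> modulo the Hodge filtration.\<close>

lemma slice_tilde_quotient_bases:
  assumes M: "slice B h d X \<delta> M" and \<delta>: "\<delta> \<le> h"
  shows "E.subspace (slice_tilde B d X \<delta> M i)" "slice_tilde B d X \<delta> M i \<subseteq> isotypic B X i"
    "\<exists>b. quotient_basis (scl X) \<delta> (isotypic B X i) (slice_tilde B d X \<delta> M i) b"
    "\<exists>b. quotient_basis (scl X) (h - \<delta>) (slice_tilde B d X \<delta> M i) {0} b"
proof -
  have Mi: "E.subspace (M i')" "M i' \<subseteq> isotypic B X i'" using M i'_less by (auto simp: slice_def)
  note H = hodge_split[OF i'_less]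
  have dh: "d i' \<le> h" using hodge_rank_le[OF i'_less] .
  show "E.subspace (slice_tilde B d X \<delta> M i)" "slice_tilde B d X \<delta> M i \<subseteq> isotypic B X i"
    unfolding slice_tilde_def i'[symmetric]
    using Ver_preimage_subspace Frob_image_subspace Frob_image_subset[OF Mi(2)] by auto
  have "(\<exists>b. quotient_basis (scl X) \<delta> (isotypic B X i) (slice_tilde B d X \<delta> M i) b) \<and>
    (\<exists>b. quotient_basis (scl X) (h - \<delta>) (slice_tilde B d X \<delta> M i) {0} b)"
  proof (cases "\<delta> \<le> d i'")
    case True
    have td: "slice_tilde B d X \<delta> M i = {x \<in> isotypic B X i. Ver X x \<in> tw X (M i')}"
      using True by (simp add: slice_tilde_def i')
    have Ms: "\<exists>b \<phi>. split_basis (scl X) (d i' - \<delta>) (M i') {0} b \<phi>" "M i' \<subseteq> hodge_isotypic B X i'"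
      using M i'_less True by (auto simp: slice_def)
    have "\<exists>b \<phi>. split_basis (scl X) \<delta> (hodge_isotypic B X i') (M i') b \<phi>"
      using split_quotient[OF Ms(1) H(3) Mi(1) Ms(2)] True by simp
    from quotient_Ver_preimage[OF this order_refl Ms(2)]
    have 1: "\<exists>b. quotient_basis (scl X) \<delta> (isotypic B X i) (slice_tilde B d X \<delta> M i) b"
      unfolding Ver_preimage_hodge td .
    have 0: "{0} \<subseteq> M i'" using E.subspace_0[OF Mi(1)] by simp
    obtain b where b: "quotient_basis (scl X) (d i' - \<delta>) (slice_tilde B d X \<delta> M i) (Frob X ` tw X (isotypic B X i')) b"
      using quotient_Ver_preimage[OF Ms(1,2) 0] unfolding Ver_preimage_zero td by blast
    have "\<exists>b. quotient_basis (scl X) (h - d i') (Frob X ` tw X (isotypic B X i')) (Frob X ` tw X (hodge_isotypic B X i')) b"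
      by (rule quotient_Frob_image[OF split_quotient[OF H(3) isotypic_split[OF i'_less] H(1,2)] order_refl H(2) order_refl])
    then obtain b' where b': "quotient_basis (scl X) (h - d i') (Frob X ` tw X (isotypic B X i')) {0} b'"
      unfolding Frob_hodge by blast
    have sub: "Frob X ` tw X (isotypic B X i') \<subseteq> slice_tilde B d X \<delta> M i"
      unfolding td Ver_preimage_zero[symmetric] using tw_mono[OF 0] by blast
    have "(d i' - \<delta>) + (h - d i') = h - \<delta>" using True dh by simp
    with E.quotient_basis_concat[OF b b' Frob_image_subspace E.subspace_single_0 _ sub]
    have "\<exists>b. quotient_basis (scl X) (h - \<delta>) (slice_tilde B d X \<delta> M i) {0} b"
      using E.subspace_0[OF Frob_image_subspace] by auto
    then show ?thesis using 1 by blast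
  next
    case False
    have td: "slice_tilde B d X \<delta> M i = Frob X ` tw X (M i')"
      using False by (simp add: slice_tilde_def i')
    have Ms: "\<exists>b \<phi>. split_basis (scl X) (h + d i' - \<delta>) (M i') {0} b \<phi>" "hodge_isotypic B X i' \<subseteq> M i'"
      using M i'_less False by (auto simp: slice_def)
    have 0: "{0} \<subseteq> hodge_isotypic B X i'" using E.subspace_0[OF H(1)] by simp
    obtain b where b: "quotient_basis (scl X) (d i') (isotypic B X i) (Frob X ` tw X (isotypic B X i')) b"
      using quotient_Ver_preimage[OF H(3) order_refl 0] unfolding Ver_preimage_zero Ver_preimage_hodge by blast
    have "\<exists>b \<phi>. split_basis (scl X) (\<delta> - d i') (isotypic B X i') (M i') b \<phi>"
      using split_quotient[OF Ms(1) isotypic_split[OF i'_less] Mi] False \<delta> by simp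
    then obtain b' where b': "quotient_basis (scl X) (\<delta> - d i') (Frob X ` tw X (isotypic B X i')) (slice_tilde B d X \<delta> M i) b'"
      using quotient_Frob_image[OF _ Ms(2) Mi(2) order_refl] unfolding td by blast
    have sub: "E.subspace (slice_tilde B d X \<delta> M i)"
        "slice_tilde B d X \<delta> M i \<subseteq> Frob X ` tw X (isotypic B X i')"
      unfolding td by (rule Frob_image_subspace, rule image_mono[OF tw_mono[OF Mi(2)]])
    have "d i' + (\<delta> - d i') = \<delta>" using False by simp
    with E.quotient_basis_concat[OF b b' Frob_image_subspace sub Frob_image_subset[OF order_refl]]
    have 1: "\<exists>b. quotient_basis (scl X) \<delta> (isotypic B X i) (slice_tilde B d X \<delta> M i) b"
      by auto
    have "\<exists>b \<phi>. split_basis (scl X) (h - \<delta>) (M i') (hodge_isotypic B X i') b \<phi>"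
      using split_quotient[OF H(3) Ms(1) H(1) Ms(2)] False by simp
    from quotient_Frob_image[OF this order_refl Ms(2) Mi(2)]
    show ?thesis using 1 unfolding td Frob_hodge by blast
  qed
  then show "\<exists>b. quotient_basis (scl X) \<delta> (isotypic B X i) (slice_tilde B d X \<delta> M i) b"
    "\<exists>b. quotient_basis (scl X) (h - \<delta>) (slice_tilde B d X \<delta> M i) {0} b" by blast+
qed

text \<open>Needed because \<open>adequate_det\<close> is a choice by \<open>SOME\<close>: without a
  witness the chosen element would be arbitrary.\<close>

lemma slice_det_exists:
  assumes M: "slice B h d X \<delta> M" and \<delta>: "\<delta> \<le> h"
  shows "\<exists>t. slice_det B h d X \<delta> M i t"
proof -
  note Q = slice_tilde_quotient_bases[OF M \<delta>]
  note H = hodge_split[OF i]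
  have Mi: "E.subspace (M i)" "M i \<subseteq> isotypic B X i" using M i by (auto simp: slice_def)
  show ?thesis
  proof (cases "\<delta> \<le> d i")
    case True
    have Ms: "\<exists>b \<phi>. split_basis (scl X) (d i - \<delta>) (M i) {0} b \<phi>" "M i \<subseteq> hodge_isotypic B X i"
      using M i True by (auto simp: slice_def)
    have "\<exists>b \<phi>. split_basis (scl X) \<delta> (hodge_isotypic B X i) (M i) b \<phi>"
      using split_quotient[OF Ms(1) H(3) Mi(1) Ms(2)] True by simp
    then obtain b where "quotient_basis (scl X) \<delta> (hodge_isotypic B X i) (M i) b"
      using E.split_basis_imp_quotient_basis[OF _ Mi(1)] by blast
    then show ?thesis
      using Q(3) E.natural_map_det_exists[OF _ _ H(2)] True unfolding slice_det_def by auto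
  next
    case False
    have Ms: "\<exists>b \<phi>. split_basis (scl X) (h + d i - \<delta>) (M i) {0} b \<phi>" "hodge_isotypic B X i \<subseteq> M i"
        "slice_tilde B d X \<delta> M i \<subseteq> M i"
      using M i False by (auto simp: slice_def)
    have "\<exists>b \<phi>. split_basis (scl X) (h - \<delta>) (M i) (hodge_isotypic B X i) b \<phi>"
      using split_quotient[OF H(3) Ms(1) H(1) Ms(2)] False by simp
    then obtain b where "quotient_basis (scl X) (h - \<delta>) (M i) (hodge_isotypic B X i) b"
      using E.split_basis_imp_quotient_basis[OF _ H(1)] by blast
    then show ?thesis
      using Q(4) E.natural_map_det_exists[OF _ _ Ms(3)] False unfolding slice_det_def by auto
  qed
qed

text \<open>The determinant generates the zeroth Fitting ideal of the cokernel of the natural map (or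
  of its dual), which only depends on \<open>slice_tilde\<close>.\<close>

lemma slice_det_dvd:
  assumes M: "slice B h d X \<delta> M" and M1: "slice B h d X \<delta> M1" and \<delta>: "\<delta> \<le> h"
    and eq: "slice_tilde B d X \<delta> M i = slice_tilde B d X \<delta> M1 i"
    and t: "slice_det B h d X \<delta> M i t" and t1: "slice_det B h d X \<delta> M1 i t1"
  shows "t dvd t1"
proof -
  note Q = slice_tilde_quotient_bases[OF M \<delta>]
  note H = hodge_split[OF i]
  show ?thesis
  proof (cases "\<delta> \<le> d i")
    case True
    have "M i \<subseteq> slice_tilde B d X \<delta> M i" using M i True by (auto simp: slice_def)
    then show ?thesis
      using E.natural_map_det_dvd[OF _ _ Q(1) _ isotypic_subspace] t t1 eq True
      unfolding slice_det_def by auto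
  next
    case False
    have Ms: "\<exists>b \<phi>. split_basis (scl X) (h + d i - \<delta>) (M1 i) {0} b \<phi>" "hodge_isotypic B X i \<subseteq> M1 i"
        "slice_tilde B d X \<delta> M1 i \<subseteq> M1 i" "E.subspace (M1 i)"
      using M1 i False by (auto simp: slice_def)
    \<comment> \<open>Here the target \<open>M i\<close> also varies, so the comparison goes through
      \<open>t2\<close>: first the target is replaced by \<open>M1 i\<close>, then bases are
      compared in the new target.\<close>
    obtain b \<phi> where "split_basis (scl X) (h - \<delta>) (M1 i) (hodge_isotypic B X i) b \<phi>"
      using split_quotient[OF H(3) Ms(1) H(1) Ms(2)] False by auto
    moreover have nt: "natural_map_det (scl X) (h - \<delta>) (slice_tilde B d X \<delta> M1 i) {0} (M i) (hodge_isotypic B X i) t"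
      using t eq False by (simp add: slice_det_def)
    ultimately obtain t2 where t2: "t dvd t2"
        "natural_map_det (scl X) (h - \<delta>) (slice_tilde B d X \<delta> M1 i) {0} (M1 i) (hodge_isotypic B X i) t2"
      using E.natural_map_det_change_target[OF nt _ Ms(3) H(1)] by blast
    have "t2 dvd t1"
      using E.natural_map_det_dvd[OF t2(2) _ H(1) _ Ms(4)] t1 False E.subspace_0[OF H(1)]
      by (simp add: slice_det_def)
    then show ?thesis using t2(1) dvd_trans by blast
  qed
qed

text \<open>The filtrations agree up to the annihilator of the determinant, which Frobenius kills.\<close>

lemma tw_slice_unique:
  assumes M: "slice B h d X \<delta> M" and M1: "slice B h d X \<delta> M1" and \<delta>: "\<delta> \<le> h"
    and eq: "slice_tilde B d X \<delta> M i = slice_tilde B d X \<delta> M1 i"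
    and t: "slice_det B h d X \<delta> M i t" and small: "trunc_val B t < 1 / 2"
  shows "tw X (M i) = tw X (M1 i)"
proof -
  note Q = slice_tilde_quotient_bases[OF M \<delta>]
  note H = hodge_split[OF i]
  have Mi: "E.subspace (M i)" "M i \<subseteq> isotypic B X i" using M i by (auto simp: slice_def)
  have M1i: "E.subspace (M1 i)" "M1 i \<subseteq> isotypic B X i" using M1 i by (auto simp: slice_def)
  have kill: "c ^ prm B = 0" if "c * t = 0" for c
    using power_eq_0_if_annihilates[OF B small that] .
  show ?thesis
  proof (cases "\<delta> \<le> d i")
    case True
    have Ms: "\<exists>b \<phi>. split_basis (scl X) (d i - \<delta>) (M i) {0} b \<phi>" "M i \<subseteq> slice_tilde B d X \<delta> M i"
      using M i True by (auto simp: slice_def)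
    have Ms1: "\<exists>b \<phi>. split_basis (scl X) (d i - \<delta>) (M1 i) {0} b \<phi>" "M1 i \<subseteq> hodge_isotypic B X i"
        "M1 i \<subseteq> slice_tilde B d X \<delta> M i"
      using M1 i True eq by (auto simp: slice_def)
    have nt: "natural_map_det (scl X) \<delta> (hodge_isotypic B X i) (M i) (isotypic B X i) (slice_tilde B d X \<delta> M i) t"
      using t True by (simp add: slice_det_def)
    have "twi X x \<in> twi X ` M i" if x: "x \<in> M1 i" for x
    proof -
      obtain c b where c: "\<And>k. k < \<delta> \<Longrightarrow> c k * t = 0" "x - (\<Sum>k<\<delta>. scl X (c k) (b k)) \<in> M i"
        using E.natural_map_det_annihilates_kernel[OF nt H(1) Mi(1) isotypic_subspace Q(1) Ms(2)] Ms1 x by blast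
      then show ?thesis using W.twist_kills_nilpotent[OF c(2)] kill by blast
    qed
    then have "tw X (M1 i) \<subseteq> tw X (M i)" unfolding tw_def by (intro T.span_mono) blast
    then show ?thesis using tw_eq_if_subset[OF Ms1(1) Ms(1)] by blast
  next
    case False
    have Ms: "\<exists>b \<phi>. split_basis (scl X) (h + d i - \<delta>) (M i) {0} b \<phi>"
      using M i False by (auto simp: slice_def)
    have Ms1: "\<exists>b \<phi>. split_basis (scl X) (h + d i - \<delta>) (M1 i) {0} b \<phi>" "hodge_isotypic B X i \<subseteq> M1 i"
        "slice_tilde B d X \<delta> M i \<subseteq> M1 i"
      using M1 i False eq by (auto simp: slice_def)
    have nt: "natural_map_det (scl X) (h - \<delta>) (slice_tilde B d X \<delta> M i) {0} (M i) (hodge_isotypic B X i) t"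
      using t False by (simp add: slice_det_def)
    \<comment> \<open>These functionals measure the distance to \<open>M1 i\<close>. As
      \<open>t\<close> carries \<open>M i\<close> into \<open>M1 i\<close>, it annihilates their
      values on \<open>M i\<close>.\<close>
    obtain n e \<psi> where e: "split_basis (scl X) n (isotypic B X i) (M1 i) e \<psi>"
      using split_quotient[OF Ms1(1) isotypic_split[OF i] M1i] by blast
    have "twi X x \<in> twi X ` M1 i" if x: "x \<in> M i" for x
    proof -
      have tx: "scl X t x \<in> M1 i"
        by (rule E.natural_map_det_annihilates_cokernel[OF nt M1i(1) Ms1(3,2) x])
      have "\<psi> k x * t = 0" if "k < n" for k
        using split_basisD(3)[OF e that tx] Modules.module_hom.scale[OF split_basisD(2)[OF e that]]
        by (simp add: mult.commute)
      then have "\<psi> k x ^ prm B = 0" if "k < n" for k using kill that by blast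
      moreover have "x \<in> isotypic B X i" using x Mi by blast
      ultimately show ?thesis using W.twist_kills_nilpotent[OF split_basisD(5)[OF e]] by blast
    qed
    then have "tw X (M i) \<subseteq> tw X (M1 i)" unfolding tw_def by (intro T.span_mono) blast
    then show ?thesis using tw_eq_if_subset[OF Ms Ms1(1)] by blast
  qed
qed

end

text \<open>The induction around the cycle starts at an index \<open>i0\<close> with \<open>d\<^sub>i\<^sub>0 = \<delta>\<close>, where the filtration
  is zero.\<close>

lemma slice_tilde_unique:
  assumes M: "slice B h d X \<delta> M" and M1: "slice B h d X \<delta> M1" and \<delta>: "\<delta> \<le> h"
    and t: "\<And>i. i < dgr B \<Longrightarrow> slice_det B h d X \<delta> M i (t i) \<and> trunc_val B (t i) < 1 / 2"
    and i0: "i0 < dgr B" "d i0 = \<delta>" and i: "i < dgr B"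
  shows "slice_tilde B d X \<delta> M i = slice_tilde B d X \<delta> M1 i"
proof -
  have tilde_eq: "slice_tilde B d X \<delta> M i = slice_tilde B d X \<delta> M1 i"
    if "tw X (M (prev_index B i)) = tw X (M1 (prev_index B i))" for i
    using that by (simp add: slice_tilde_def)
  have "tw X (M i) = tw X (M1 i)" if "i < dgr B" for i
  proof (rule cyclic_induct[OF i0(1) _ _ that])
    have "M' i0 = {0}" if M': "slice B h d X \<delta> M'" for M'
    proof -
      obtain b \<phi> where "split_basis (scl X) 0 (M' i0) {0} b \<phi>" "E.subspace (M' i0)"
        using M'[unfolded slice_def, rule_format, OF i0(1)] i0(2) by auto
      then show ?thesis using E.subspace_0 by (auto simp: split_basis_def)
    qed
    from this[OF M] this[OF M1] show "tw X (M i0) = tw X (M1 i0)" by simp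
  next
    fix i assume i: "i < dgr B" and "tw X (M (prev_index B i)) = tw X (M1 (prev_index B i))"
    then show "tw X (M i) = tw X (M1 i)"
      using tw_slice_unique[OF i refl M M1 \<delta> tilde_eq] t[OF i] by blast
  qed
  then show ?thesis using tilde_eq prev_index_less[OF i] by blast
qed

text \<open>The bound on \<open>M\<close> makes the two tilde modules equal. That equality is
  symmetric, so the determinants divide each other, for every admissible choice of
  \<open>t1\<close>.\<close>

lemma slice_val_unique:
  assumes M: "slice B h d X \<delta> M" and M1: "slice B h d X \<delta> M1" and \<delta>: "\<delta> \<le> h"
    and t: "\<And>i. i < dgr B \<Longrightarrow> slice_det B h d X \<delta> M i (t i) \<and> trunc_val B (t i) < 1 / 2"
    and i0: "i0 < dgr B" "d i0 = \<delta>" and i: "i < dgr B" and t1: "slice_det B h d X \<delta> M1 i t1"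
  shows "trunc_val B t1 = trunc_val B (t i)"
proof -
  have eq: "slice_tilde B d X \<delta> M i = slice_tilde B d X \<delta> M1 i"
    by (rule slice_tilde_unique[OF M M1 \<delta> t i0 i])
  have "t i dvd t1" "t1 dvd t i"
    using slice_det_dvd[OF i refl M M1 \<delta> eq _ t1] slice_det_dvd[OF i refl M1 M \<delta> eq[symmetric] t1] t[OF i]
    by blast+
  then show ?thesis using trunc_val_dvd_mono[OF B] by (intro antisym) blast+
qed

end

section \<open>The slices of an adequate filtration\<close>

lemma delta_in_jumps:
  assumes "j \<in> {1..njumps B h d}"
  shows "delta B h d j \<in> jumps B h d"
proof -
  have fin: "finite (jumps B h d)" by (simp add: jumps_def)
  have "j - 1 < length (sorted_list_of_set (jumps B h d))"
    using assms by (auto simp: njumps_def)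
  from nth_mem[OF this] show ?thesis using assms fin by (simp add: delta_def)
qed

text \<open>The interior values are jumps, hence strictly between \<open>0\<close> and
  \<open>h\<close>; \<open>0 < h\<close> separates the two extreme values when there are no
  jumps.\<close>

lemma delta_strict_mono:
  assumes "0 < h" "a < b" "b \<le> njumps B h d + 1"
  shows "delta B h d a < delta B h d b"
proof -
  let ?l = "sorted_list_of_set (jumps B h d)"
  have len: "length ?l = njumps B h d" by (simp add: njumps_def)
  have bounds: "0 < delta B h d j \<and> delta B h d j < h" if "j \<in> {1..njumps B h d}" for j
    using delta_in_jumps[OF that] by (auto simp: jumps_def)
  show ?thesis
  proof (cases "a = 0 \<or> b = njumps B h d + 1")
    case True
    then show ?thesis
      using bounds[of a] bounds[of b] assms by (auto simp: delta_def split: if_splits)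
  next
    case False
    then have "delta B h d a = ?l ! (a - 1)" "delta B h d b = ?l ! (b - 1)" "a - 1 < b - 1" "b - 1 < length ?l"
      using assms len by (auto simp: delta_def)
    then show ?thesis using strict_sorted_list_of_set[of "jumps B h d"] by (simp add: sorted_wrt_iff_nth_less)
  qed
qed

text \<open>As \<open>delta\<close> is strictly increasing, \<open>LEAST\<close> picks the only
  index with value \<open>d i\<close>. One exists because \<open>d i\<close> is a jump or, by
  \<open>d i \<le> h\<close>, equal to \<open>0\<close> or \<open>h\<close>.\<close>

lemma delta_le_iff_le_jump_index:
  assumes i: "i < dgr B" and "d i \<le> h" and j: "j \<in> {1..njumps B h d}"
  shows "delta B h d j \<le> d i \<longleftrightarrow> j \<le> jump_index B h d i"
    and "delta B h d j = d i \<longleftrightarrow> j = jump_index B h d i"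
proof -
  have "0 < h" using delta_in_jumps[OF j] by (auto simp: jumps_def)
  have "\<exists>j. j \<le> njumps B h d + 1 \<and> delta B h d j = d i"
  proof (cases "d i \<in> jumps B h d")
    case True
    moreover have "finite (jumps B h d)" by (simp add: jumps_def)
    ultimately have "d i \<in> set (sorted_list_of_set (jumps B h d))" by simp
    then obtain k where k: "k < length (sorted_list_of_set (jumps B h d))"
        "sorted_list_of_set (jumps B h d) ! k = d i"
      unfolding in_set_conv_nth by blast
    \<comment> \<open>\<open>delta\<close> numbers the jumps from \<open>1\<close>, the sorted list
      from \<open>0\<close>.\<close>
    then show ?thesis by (intro exI[of _ "Suc k"]) (simp add: delta_def njumps_def)
  next
    case False
    moreover have "d i \<in> d ` {..<dgr B}" using i by simp
    ultimately have "\<not> (1 \<le> d i \<and> d i < h)" by (simp add: jumps_def)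
    then have "d i = 0 \<or> d i = h" using assms(2) by linarith
    moreover have "delta B h d 0 = 0" "delta B h d (njumps B h d + 1) = h" by (simp_all add: delta_def)
    ultimately show ?thesis by (metis le0 order_refl)
  qed
  from LeastI_ex[OF this]
  have s: "jump_index B h d i \<le> njumps B h d + 1" "delta B h d (jump_index B h d i) = d i"
    unfolding jump_index_def by blast+
  have "j \<le> njumps B h d + 1" using j by simp
  then have lt: "j < jump_index B h d i \<Longrightarrow> delta B h d j < d i"
      "jump_index B h d i < j \<Longrightarrow> d i < delta B h d j"
    using delta_strict_mono[OF \<open>0 < h\<close>, of j "jump_index B h d i" B d]
      delta_strict_mono[OF \<open>0 < h\<close>, of "jump_index B h d i" j B d] s by auto
  show "delta B h d j \<le> d i \<longleftrightarrow> j \<le> jump_index B h d i"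
    using lt s by (cases j "jump_index B h d i" rule: linorder_cases) auto
  show "delta B h d j = d i \<longleftrightarrow> j = jump_index B h d i"
    using lt s by (cases j "jump_index B h d i" rule: linorder_cases) auto
qed

lemma adequate_imp_slice:
  fixes B :: "('k::field_char_0, 'l::field_char_0, 'r::comm_ring_1) base_data"
    and X :: "('l, 'r, 'e::ab_group_add, 't::ab_group_add) dieudonne"
  assumes B: "admissible_base B" and X: "dieudonne_module B h d X"
    and Fil: "adequate B h d X Fil" and j: "j \<in> {1..njumps B h d}"
  shows "slice B h d X (delta B h d j) (\<lambda>i. Fil i j)"
    and "i < dgr B \<Longrightarrow> slice_det B h d X (delta B h d j) (\<lambda>i. Fil i j) i (adequate_det B h d X Fil i j)"
proof -
  let ?\<delta> = "delta B h d j" and ?M = "\<lambda>i. Fil i j"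
  interpret E: Modules.module "scl X" using X by (simp add: dieudonne_module_def)
  note iff = delta_le_iff_le_jump_index[OF _ hodge_rank_le[OF B X] j]
  have tilde: "tilde B h d X Fil i j = slice_tilde B d X ?\<delta> ?M i" if "i < dgr B" for i
    using iff(1)[of "prev_index B i"] prev_index_less[OF that] by (simp add: tilde_def slice_tilde_def)
  show slice: "slice B h d X ?\<delta> ?M"
    unfolding slice_def
  proof (intro allI impI)
    fix i assume i: "i < dgr B"
    note iff = iff[OF i i]
    note H = hodge_split[OF B X i]
    note adq = Fil[unfolded adequate_def, rule_format, OF i j]
    consider "j < jump_index B h d i" | "j = jump_index B h d i" | "jump_index B h d i < j" by linarith
    then show "E.subspace (Fil i j) \<and> Fil i j \<subseteq> isotypic B X i \<and>
      (if ?\<delta> \<le> d i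
       then (\<exists>b \<phi>. split_basis (scl X) (d i - ?\<delta>) (Fil i j) {0} b \<phi>) \<and>
         Fil i j \<subseteq> hodge_isotypic B X i \<and> Fil i j \<subseteq> slice_tilde B d X ?\<delta> ?M i
       else (\<exists>b \<phi>. split_basis (scl X) (h + d i - ?\<delta>) (Fil i j) {0} b \<phi>) \<and>
         hodge_isotypic B X i \<subseteq> Fil i j \<and> slice_tilde B d X ?\<delta> ?M i \<subseteq> Fil i j)"
    proof cases
      case 1
      then have "direct_factor (scl X) (d i - ?\<delta>) (Fil i j) (isotypic B X i)"
        "Fil i j \<subseteq> hodge_isotypic B X i" "Fil i j \<subseteq> slice_tilde B d X ?\<delta> ?M i"
        using adq tilde[OF i] by auto
      then show ?thesis using direct_factor_split[OF B X i] iff 1 by simp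
    next
      case 2
      then have 0: "Fil i j = {0}" "?\<delta> = d i" using adq iff by auto
      \<comment> \<open>With no basis vectors there is nothing to check about the witnesses; only
        \<open>0 \<in> {0}\<close> remains.\<close>
      have "split_basis (scl X) 0 {0} {0} undefined undefined" by (simp add: split_basis_def)
      moreover have "0 \<in> slice_tilde B d X ?\<delta> ?M i"
        by (rule slice_tilde_zero[OF B X])
      ultimately show ?thesis
        using 0 E.subspace_0[OF H(1)] E.subspace_0[OF isotypic_subspace[OF B X]] by auto
    next
      case 3
      then have "direct_factor (scl X) (h + d i - ?\<delta>) (Fil i j) (isotypic B X i)"
        "hodge_isotypic B X i \<subseteq> Fil i j" "slice_tilde B d X ?\<delta> ?M i \<subseteq> Fil i j"
        using adq tilde[OF i] by auto
      then show ?thesis using direct_factor_split[OF B X i] iff 3 by simp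
    qed
  qed
  assume i: "i < dgr B"
  have "?\<delta> \<le> h" using delta_in_jumps[OF j] by (auto simp: jumps_def)
  then have "\<exists>t. slice_det B h d X ?\<delta> ?M i t" by (rule slice_det_exists[OF B X i refl slice])
  moreover have "adequate_det B h d X Fil i j = (SOME t. slice_det B h d X ?\<delta> ?M i t)"
    using iff(1)[OF i i] tilde[OF i] by (simp add: adequate_det_def slice_det_def)
  ultimately show "slice_det B h d X ?\<delta> ?M i (adequate_det B h d X Fil i j)"
    using someI_ex by metis
qed

section \<open>Transport along isomorphisms\<close>

context Modules.module_hom
begin

lemma inv_combination:
  assumes "bij f"
  shows "f (x - (\<Sum>k<n. s1 (c k) (inv_into UNIV f (b k)))) = f x - (\<Sum>k<n. s2 (c k) (b k))"
  using assms by (simp add: diff sum scale bij_is_surj surj_f_inv_f)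

text \<open>Pulling back is the convenient direction: functionals on the target simply compose with
  \<open>f\<close>.\<close>

lemma split_basis_vimage:
  assumes f: "bij f" and b: "split_basis s2 n M M' b \<phi>"
  shows "split_basis s1 n (f -` M) (f -` M') (\<lambda>k. inv_into UNIV f (b k)) (\<lambda>k x. \<phi> k (f x))"
  unfolding split_basis_def
proof (intro conjI allI impI ballI)
  fix k assume k: "k < n"
  show "Modules.module_hom s1 (*) (\<lambda>x. \<phi> k (f x))"
    using module_hom_compose[OF module_hom_axioms split_basisD(2)[OF b k]] by (simp add: comp_def)
qed (use split_basisD[OF b] f in \<open>auto simp: inv_combination bij_is_surj surj_f_inv_f\<close>)

lemma quotient_basis_vimage:
  assumes f: "bij f" and b: "quotient_basis s2 n M M' b"
  shows "quotient_basis s1 n (f -` M) (f -` M') (\<lambda>k. inv_into UNIV f (b k))"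
  using b f unfolding quotient_basis_def vimage_eq
  by (auto simp: inv_combination bij_is_surj surj_f_inv_f)

text \<open>The transported bases have the same matrix \<open>m\<close>, so the determinant is
  preserved exactly and not only up to a unit.\<close>

lemma natural_map_det_vimage:
  assumes f: "bij f" and t: "natural_map_det s2 n M M' N N' t"
  shows "natural_map_det s1 n (f -` M) (f -` M') (f -` N) (f -` N') t"
proof -
  obtain b b' m where b: "quotient_basis s2 n M M' b" "quotient_basis s2 n N N' b'"
    and m: "\<And>k. k < n \<Longrightarrow> b k - (\<Sum>l<n. s2 (m (l, k)) (b' l)) \<in> N'" and t: "t = Determinant.det (Matrix.mat n n m)"
    using t unfolding natural_map_det_def by blast
  have "inv_into UNIV f (b k) - (\<Sum>l<n. s1 (m (l, k)) (inv_into UNIV f (b' l))) \<in> f -` N'" if "k < n" for k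
    using m[OF that] f by (simp add: inv_combination bij_is_surj surj_f_inv_f)
  then show ?thesis
    using quotient_basis_vimage[OF f b(1)] quotient_basis_vimage[OF f b(2)] t
    unfolding natural_map_det_def by blast
qed

end

context
  fixes B :: "('k::field_char_0, 'l::field_char_0, 'r::comm_ring_1) base_data"
    and X :: "('l, 'r, 'e::ab_group_add, 't::ab_group_add) dieudonne"
    and Y :: "('l, 'r, 'e1::ab_group_add, 't1::ab_group_add) dieudonne"
    and g g'
  assumes bij: "bij g" "bij g'"
    and hom: "Modules.module_hom (scl X) (scl Y) g" "Modules.module_hom (scl_tw X) (scl_tw Y) g'"
    and twi: "\<And>x. g' (twi X x) = twi Y (g x)"
    and act: "\<And>a x. a \<in> val_ring (valF B) \<Longrightarrow> g (act X a x) = act Y a (g x)"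
    and FV: "\<And>y. g (Frob X y) = Frob Y (g' y)" "\<And>x. g' (Ver X x) = Ver Y (g x)"
    and hodge: "g ` hodge X = hodge Y"
begin

interpretation G: Modules.module_hom "scl X" "scl Y" g by (rule hom)
interpretation G': Modules.module_hom "scl_tw X" "scl_tw Y" g' by (rule hom)

lemma inj_iso: "g x = g y \<longleftrightarrow> x = y"
  using bij(1) by (simp add: bij_def inj_eq)

lemma isotypic_vimage: "g -` isotypic B Y i = isotypic B X i"
proof -
  have "act Y a (g x) = scl Y c (g x) \<longleftrightarrow> act X a x = scl X c x" if "a \<in> val_ring (valF B)" for a c x
    using inj_iso[of "act X a x" "scl X c x"] act[OF that] G.scale by simp
  then show ?thesis by (auto simp: isotypic_def)
qed

lemma hodge_isotypic_vimage: "g -` hodge_isotypic B Y i = hodge_isotypic B X i"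
  using isotypic_vimage[of i] inj_vimage_image_eq[OF bij_is_inj[OF bij(1)], of "hodge X"]
  by (auto simp: hodge_isotypic_def hodge)

lemma tw_vimage: "g' -` tw Y N = tw X (g -` N)"
proof -
  have "g ` (g -` N) = N" using bij(1) by (simp add: bij_is_surj surj_image_vimage_eq)
  then have "twi Y ` N = g' ` (twi X ` (g -` N))" by (metis (no_types, lifting) image_cong image_image twi)
  then have "tw Y N = g' ` tw X (g -` N)" unfolding tw_def by (simp add: G'.span_image)
  then show ?thesis by (simp add: inj_vimage_image_eq[OF bij_is_inj[OF bij(2)]])
qed

lemma slice_tilde_vimage:
  "g -` slice_tilde B d Y \<delta> M i = slice_tilde B d X \<delta> (\<lambda>i. g -` M i) i"
proof (cases "\<delta> \<le> d (prev_index B i)")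
  case True
  then show ?thesis
    using isotypic_vimage[of i] by (auto simp: slice_tilde_def tw_vimage[symmetric] FV)
next
  case False
  have "g x \<in> Frob Y ` N \<longleftrightarrow> x \<in> Frob X ` (g' -` N)" for x N
  proof
    assume "g x \<in> Frob Y ` N"
    then obtain y where y: "y \<in> N" "g x = Frob Y y" by blast
    have "g' (inv_into UNIV g' y) = y" using bij(2) by (simp add: bij_is_surj surj_f_inv_f)
    then have "g x = g (Frob X (inv_into UNIV g' y))" "inv_into UNIV g' y \<in> g' -` N" using y FV(1) by auto
    then show "x \<in> Frob X ` (g' -` N)" by (simp add: inj_iso)
  qed (auto simp: FV)
  then have "g -` (Frob Y ` N) = Frob X ` (g' -` N)" for N by blast
  then show ?thesis using False by (simp add: slice_tilde_def tw_vimage[symmetric])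
qed

text \<open>Turns a filtration on the isomorphic module \<open>Y\<close> into a second filtration on
  \<open>X\<close>, so that uniqueness on \<open>X\<close> covers it.\<close>

lemma slice_vimage:
  assumes "slice B h d Y \<delta> M"
  shows "slice B h d X \<delta> (\<lambda>i. g -` M i)"
  unfolding slice_def
proof (intro allI impI)
  fix i assume i: "i < dgr B"
  have 0: "g -` {0} = {0}" using inj_iso[of _ 0] G.zero by auto
  have split: "\<exists>b \<phi>. split_basis (scl X) n (g -` M i) {0} b \<phi>"
    if "\<exists>b \<phi>. split_basis (scl Y) n (M i) {0} b \<phi>" for n
    using that G.split_basis_vimage[OF bij(1), where M' = "{0}"] unfolding 0 by blast
  show "Modules.module.subspace (scl X) (g -` M i) \<and> g -` M i \<subseteq> isotypic B X i \<and>
      (if \<delta> \<le> d i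
       then (\<exists>b \<phi>. split_basis (scl X) (d i - \<delta>) (g -` M i) {0} b \<phi>) \<and>
         g -` M i \<subseteq> hodge_isotypic B X i \<and> g -` M i \<subseteq> slice_tilde B d X \<delta> (\<lambda>i. g -` M i) i
       else (\<exists>b \<phi>. split_basis (scl X) (h + d i - \<delta>) (g -` M i) {0} b \<phi>) \<and>
         hodge_isotypic B X i \<subseteq> g -` M i \<and> slice_tilde B d X \<delta> (\<lambda>i. g -` M i) i \<subseteq> g -` M i)"
    (is ?goal)
  proof (cases "\<delta> \<le> d i")
    case True
    then show ?goal
      unfolding isotypic_vimage[symmetric] hodge_isotypic_vimage[symmetric] slice_tilde_vimage[symmetric] if_P[OF True]
      by (intro conjI G.subspace_vimage split vimage_mono)
        (use assms[unfolded slice_def, rule_format, OF i] in simp_all)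
  next
    case False
    then show ?goal
      unfolding isotypic_vimage[symmetric] hodge_isotypic_vimage[symmetric] slice_tilde_vimage[symmetric] if_not_P[OF False]
      by (intro conjI G.subspace_vimage split vimage_mono)
        (use assms[unfolded slice_def, rule_format, OF i] in simp_all)
  qed
qed

lemma slice_det_vimage:
  assumes "slice_det B h d Y \<delta> M i t"
  shows "slice_det B h d X \<delta> (\<lambda>i. g -` M i) i t"
proof -
  have 0: "g -` {0} = {0}" using inj_iso[of _ 0] G.zero by auto
  show ?thesis
    using assms G.natural_map_det_vimage[OF bij(1)] G.natural_map_det_vimage[OF bij(1), where M' = "{0}"]
    unfolding slice_det_def isotypic_vimage[symmetric] hodge_isotypic_vimage[symmetric]
      slice_tilde_vimage[symmetric] 0 by (simp split: if_splits)
qed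

end

theorem corollary3p2p4:
  fixes B :: "('k::field_char_0, 'l::field_char_0, 'r::comm_ring_1) base_data"
    and X :: "('l, 'r, 'e::ab_group_add, 't::ab_group_add) dieudonne"
    and h :: nat and d :: "nat \<Rightarrow> nat"
    and Fil :: "nat \<Rightarrow> nat \<Rightarrow> 'e set"
  assumes "admissible_base B"
    and "dieudonne_module B h d X"
    and "adequate B h d X Fil"
    and "(\<Sum>i<dgr B. \<Sum>j=1..njumps B h d. adequate_val B h d X Fil i j) < 1 / 2"
  shows
    "(\<forall>Fil'. adequate B h d X Fil' \<longrightarrow>
        (\<forall>i<dgr B. \<forall>j\<in>{1..njumps B h d}.
           adequate_val B h d X Fil' i j = adequate_val B h d X Fil i j)) \<and>
     (\<forall>(Y :: ('l, 'r, 'e1::ab_group_add, 't1::ab_group_add) dieudonne) Fil'.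
        dieudonne_module B h d Y \<and> isomorphic_dieudonne B X Y \<and> adequate B h d Y Fil' \<longrightarrow>
        (\<forall>i<dgr B. \<forall>j\<in>{1..njumps B h d}.
           adequate_val B h d Y Fil' i j = adequate_val B h d X Fil i j))"
proof -
  note B = assms(1) and X = assms(2)
  have nonneg: "0 \<le> adequate_val B h d X Fil i j" for i j
    unfolding adequate_val_def by (rule trunc_val_nonneg[OF B])
  have small: "trunc_val B (adequate_det B h d X Fil i j) < 1 / 2"
    if i: "i < dgr B" and j: "j \<in> {1..njumps B h d}" for i j
  proof -
    \<comment> \<open>All terms are nonnegative, so each single valuation inherits the bound on the
      sum.\<close>
    have "adequate_val B h d X Fil i j \<le> (\<Sum>j=1..njumps B h d. adequate_val B h d X Fil i j)"
      using j nonneg by (intro member_le_sum) auto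
    also have "\<dots> \<le> (\<Sum>i<dgr B. \<Sum>j=1..njumps B h d. adequate_val B h d X Fil i j)"
      using i nonneg by (intro member_le_sum[of i "{..<dgr B}"]) (auto intro: sum_nonneg)
    finally show ?thesis using assms(4) by (simp add: adequate_val_def)
  qed
  \<comment> \<open>Stated for arbitrary slices and determinants, so that it applies both to another
    filtration on \<open>X\<close> and to one pulled back from \<open>Y\<close>.\<close>
  have key: "trunc_val B t = adequate_val B h d X Fil i j"
    if j: "j \<in> {1..njumps B h d}" and i: "i < dgr B"
      and M: "slice B h d X (delta B h d j) M" and t: "slice_det B h d X (delta B h d j) M i t"
    for M t i j
  proof -
    \<comment> \<open>By construction \<open>delta B h d j\<close> is one of the ranks
      \<open>d i\<close>, which supplies the starting point of the cycle.\<close>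
    obtain i0 where i0: "i0 < dgr B" "d i0 = delta B h d j" and \<delta>: "delta B h d j \<le> h"
      using delta_in_jumps[OF j] by (auto simp: jumps_def)
    note Fil = adequate_imp_slice[OF B X assms(3) j]
    show ?thesis
      unfolding adequate_val_def
      by (rule slice_val_unique[OF B X Fil(1) M \<delta> _ i0 i t, of "\<lambda>i. adequate_det B h d X Fil i j"])
        (use Fil(2) small[OF _ j] in blast)
  qed
  show ?thesis
  proof (intro conjI allI impI ballI)
    fix Fil' i j
    assume "adequate B h d X Fil'" and i: "i < dgr B" and j: "j \<in> {1..njumps B h d}"
    note Fil' = adequate_imp_slice[OF B X this(1) j]
    show "adequate_val B h d X Fil' i j = adequate_val B h d X Fil i j"
      using key[OF j i Fil'(1) Fil'(2)[OF i]] by (simp add: adequate_val_def)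
  next
    fix Y :: "('l, 'r, 'e1, 't1) dieudonne" and Fil' i j
    assume Y: "dieudonne_module B h d Y \<and> isomorphic_dieudonne B X Y \<and> adequate B h d Y Fil'"
      and i: "i < dgr B" and j: "j \<in> {1..njumps B h d}"
    have "dieudonne_module B h d Y" "adequate B h d Y Fil'" using Y by auto
    note Fil' = adequate_imp_slice[OF B this j]
    obtain g g' where g: "bij g" "bij g'"
      "Modules.module_hom (scl X) (scl Y) g" "Modules.module_hom (scl_tw X) (scl_tw Y) g'"
      "\<And>x. g' (twi X x) = twi Y (g x)"
      "\<And>a x. a \<in> val_ring (valF B) \<Longrightarrow> g (act X a x) = act Y a (g x)"
      "\<And>y. g (Frob X y) = Frob Y (g' y)" "\<And>x. g' (Ver X x) = Ver Y (g x)" "g ` hodge X = hodge Y"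
      using Y unfolding isomorphic_dieudonne_def by metis
    show "adequate_val B h d Y Fil' i j = adequate_val B h d X Fil i j"
      using key[OF j i slice_vimage[OF g Fil'(1)] slice_det_vimage[OF g Fil'(2)[OF i]]]
      by (simp add: adequate_val_def)
  qed
qed

end
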